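(* Let $X$ be a real Hilbert space, $N\geq1$ an integer, $(\tau_n^j)_{n\in\mathbb N}$, $j=1,\dots,N$, sequences of (invertible linear) isometries of $X$, $A$, $B^1,\dots,B^N$ linear operators and $(R_n)_{n\in\mathbb N}$ a sequence of linear operators in $X$. Set $\tau_n^{k/j}=\tau_n^k(\tau_n^j)^{-1}$, $B_n^j=(\tau_n^j)^{-1}B^j\tau_n^j$. Assume: (A1) For all $j=1,\dots,N$ and $n\in\mathbb N$, the operators $A$, $A+B^j$, $A+B^j_n$, $A+\sum_{j=1}^NB^j_n+R_n$ are self-adjoint with the same domain $D(A)$. (A2) $A$ is invertible, and for all $j=1,\dots,N$ and $n\in\mathbb N$, $A$ commutes with $\tau_n^j$, i.e. $A=(\tau_n^j)^{-1}A\tau_n^j$. (A3) There exists $\delta>0$ such that for all $j=1,\dots,N$ and $n\in\mathbb N$ the spectra of $A$, $A+B^j$, $A+B^j_n$, $A+\sum_{j=1}^NB^j_n+R_n$ in $(-\infty,\delta)$ consist of a finite number of eigenvalues with finite geometric multiplicities. (A4) For every $\lambda\in\bigcap_{j=1}^N\rho(A+B^j)$ and all $j=1,\dots,N$, the operators $A(A+B^j-\lambda I)^{-1}$ are bounded. (A5) $\|R_nA^{-1}\|\to0$ in operator norm as $n\to\infty$. (A6) For all $u\in D(A)$ and all $j\neq l$ in $\{1,\dots,N\}$, $\lim_{n\to\infty}\|\tau_n^{j/l}B^l\tau_n^{l/j}u\|_X=0$. (A7) For all $u\in X$ and all $j\neq k$ in $\{1,\dots,N\}$, $\tau_n^{j/k}u\rightharpoonup0$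 weakly in $X$ as $n\to\infty$. (A8) For all $j=1,\dots,N$, the operator $B^jA^{-1}$ is compact. Define $L_n=A+\sum_{j=1}^NB_n^j+R_n$ with domain $D(A)$. If there exists $n_L$ such that for all $n\geq n_L$ \[ \dim(\ker(L_n))\geq\sum_{j=1}^N\dim(\ker(A+B^j)), \] then for all $n\geq n_L$ \[ \operatorname{Inertia}(L_n)=\sum_{j=1}^N\operatorname{Inertia}(A+B^j). \] Moreover, a non-zero eigenvalue of $L_n$ cannot approach $0$ as $n\to\infty$.
   Context: $\rho(L)$ denotes the resolvent set of an operator $L$. For a self-adjoint operator $L$ whose spectrum in $(-\infty,\delta)$, for some $\delta>0$, consists of finitely many eigenvalues with finite geometric multiplicities, $\operatorname{Inertia}(L)$ is the pair $(n,z)$, where $n$ is the number of negative eigenvalues of $L$ counted with geometric multiplicities and $z=\dim\ker L$; pairs are added componentwise.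
   Formalization: The inertia identity is proved for all n ≥ n_0 with some n_0 ≥ n_L, not for all n ≥ n_L; the literal claim fails (X=R, N=1, τ=id, A=1, B^1=0, R_0=-2, R_n=0 for n≥1, δ=1, n_L=0). *)

theory Defs
  imports "HOL-Analysis.Analysis"
begin

text \<open>
  Possibly unbounded linear operators in a vector space are partial maps: a domain together with a
  function whose values outside the domain are irrelevant.  Sums, compositions and inverses carry
  their natural (maximal) domains.  The predicate \<open>lin_op\<close> below expresses linearity.
\<close>

record 'a operator =
  Dom :: "'a set"
  app :: "'a \<Rightarrow> 'a"

definition op_eq :: "'a operator \<Rightarrow> 'a operator \<Rightarrow> bool"  (infix "=\<^sub>o" 50) where
  "S =\<^sub>o T \<longleftrightarrow> Dom S = Dom T \<and> (\<forall>u\<in>Dom S. app S u = app T u)"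

definition everywhere :: "('a \<Rightarrow> 'a) \<Rightarrow> 'a operator" where
  "everywhere f = \<lparr>Dom = UNIV, app = f\<rparr>"

definition op_plus :: "'a::plus operator \<Rightarrow> 'a operator \<Rightarrow> 'a operator"  (infixl "+\<^sub>o" 65) where
  "S +\<^sub>o T = \<lparr>Dom = Dom S \<inter> Dom T, app = (\<lambda>u. app S u + app T u)\<rparr>"

definition op_sum :: "('i \<Rightarrow> 'a::comm_monoid_add operator) \<Rightarrow> 'i set \<Rightarrow> 'a operator" where
  "op_sum T J = \<lparr>Dom = (\<Inter>j\<in>J. Dom (T j)), app = (\<lambda>u. \<Sum>j\<in>J. app (T j) u)\<rparr>"

definition op_comp :: "'a operator \<Rightarrow> 'a operator \<Rightarrow> 'a operator"  (infixl "\<circ>\<^sub>o" 70) where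
  "S \<circ>\<^sub>o T = \<lparr>Dom = {u \<in> Dom T. app T u \<in> Dom S}, app = (\<lambda>u. app S (app T u))\<rparr>"

definition op_inv :: "'a operator \<Rightarrow> 'a operator" where
  "op_inv T = \<lparr>Dom = app T ` Dom T, app = inv_into (Dom T) (app T)\<rparr>"

definition op_shift :: "'a::real_vector operator \<Rightarrow> real \<Rightarrow> 'a operator" where
  "op_shift T \<mu> = T +\<^sub>o everywhere (\<lambda>u. - (\<mu> *\<^sub>R u))"

definition op_conj :: "('a \<Rightarrow> 'a) \<Rightarrow> 'a operator \<Rightarrow> 'a operator" where
  "op_conj t T = everywhere (inv t) \<circ>\<^sub>o T \<circ>\<^sub>o everywhere t"

definition lin_op :: "'a::real_vector operator \<Rightarrow> bool" where
  "lin_op T \<longleftrightarrow> subspace (Dom T) \<and>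
     (\<forall>u\<in>Dom T. \<forall>v\<in>Dom T. app T (u + v) = app T u + app T v) \<and>
     (\<forall>c. \<forall>u\<in>Dom T. app T (c *\<^sub>R u) = c *\<^sub>R app T u)"

definition bounded_op :: "'a::real_normed_vector operator \<Rightarrow> bool" where
  "bounded_op T \<longleftrightarrow> Dom T = UNIV \<and> bounded_linear (app T)"

definition compact_op :: "'a::real_normed_vector operator \<Rightarrow> bool" where
  "compact_op T \<longleftrightarrow> Dom T = UNIV \<and> linear (app T) \<and>
     (\<forall>S. bounded S \<longrightarrow> compact (closure (app T ` S)))"

definition op_invertible :: "'a::real_normed_vector operator \<Rightarrow> bool" where
  "op_invertible T \<longleftrightarrow> bij_betw (app T) (Dom T) UNIV \<and> bounded_op (op_inv T)"

text \<open>
  The adjoint is meaningful only for a densely defined operator; then the vector \<open>w\<close> is unique.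
\<close>

definition adjoint_op :: "'a::real_inner operator \<Rightarrow> 'a operator" where
  "adjoint_op T =
     \<lparr>Dom = {v. \<exists>w. \<forall>u\<in>Dom T. app T u \<bullet> v = u \<bullet> w},
      app = (\<lambda>v. THE w. \<forall>u\<in>Dom T. app T u \<bullet> v = u \<bullet> w)\<rparr>"

definition self_adjoint :: "'a::real_inner operator \<Rightarrow> bool" where
  "self_adjoint T \<longleftrightarrow> lin_op T \<and> closure (Dom T) = UNIV \<and> adjoint_op T =\<^sub>o T"

text \<open>
  The space is real, so the resolvent set and the spectrum are sets of real numbers.
\<close>

definition resolvent_set :: "'a::real_normed_vector operator \<Rightarrow> real set" where
  "resolvent_set T = {\<mu>. op_invertible (op_shift T \<mu>)}"

definition spectrum :: "'a::real_normed_vector operator \<Rightarrow> real set" where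
  "spectrum T = - resolvent_set T"

definition eigenspace :: "'a::real_vector operator \<Rightarrow> real \<Rightarrow> 'a set" where
  "eigenspace T \<mu> = {u \<in> Dom T. app T u = \<mu> *\<^sub>R u}"

definition eigenvalue :: "'a::real_vector operator \<Rightarrow> real \<Rightarrow> bool" where
  "eigenvalue T \<mu> \<longleftrightarrow> (\<exists>u\<in>eigenspace T \<mu>. u \<noteq> 0)"

definition op_kernel :: "'a::real_vector operator \<Rightarrow> 'a set" where
  "op_kernel T = {u \<in> Dom T. app T u = 0}"

text \<open>
  Finite dimension is stated by a finite spanning set, since \<open>dim\<close> is not informative (it is \<open>0\<close>)
  for infinite-dimensional subspaces.
\<close>

definition fin_discrete_below :: "'a::real_normed_vector operator \<Rightarrow> real \<Rightarrow> bool" where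
  "fin_discrete_below T \<delta> \<longleftrightarrow> finite (spectrum T \<inter> {..<\<delta>}) \<and>
     (\<forall>\<mu> \<in> spectrum T \<inter> {..<\<delta>}.
        eigenvalue T \<mu> \<and> (\<exists>S. finite S \<and> eigenspace T \<mu> \<subseteq> span S))"

text \<open>
  Used only under \<open>fin_discrete_below T \<delta>\<close> with \<open>\<delta> > 0\<close>, where the sum is finite and all the
  dimensions involved are genuine.
\<close>

definition inertia :: "'a::real_normed_vector operator \<Rightarrow> nat \<times> nat" where
  "inertia T = ((\<Sum>\<mu> | \<mu> < 0 \<and> eigenvalue T \<mu>. dim (eigenspace T \<mu>)), dim (op_kernel T))"

definition linear_isometry :: "('a::real_normed_vector \<Rightarrow> 'a) \<Rightarrow> bool" where
  "linear_isometry t \<longleftrightarrow> linear t \<and> bij t \<and> (\<forall>u. norm (t u) = norm u)"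

definition weakly_converges :: "(nat \<Rightarrow> 'a::real_normed_vector) \<Rightarrow> 'a \<Rightarrow> bool" where
  "weakly_converges x l \<longleftrightarrow>
     (\<forall>f :: 'a \<Rightarrow> real. bounded_linear f \<longrightarrow> (\<lambda>n. f (x n)) \<longlonglongrightarrow> f l)"

text \<open>
  Sequences of isometries are written \<open>\<tau> j n\<close>, with the superscript first and the sequence index
  second.
\<close>

definition tau_quot :: "(nat \<Rightarrow> nat \<Rightarrow> 'a \<Rightarrow> 'a) \<Rightarrow> nat \<Rightarrow> nat \<Rightarrow> nat \<Rightarrow> 'a \<Rightarrow> 'a" where
  "tau_quot \<tau> k j n = \<tau> k n \<circ> inv (\<tau> j n)"

definition B_conj ::
  "(nat \<Rightarrow> 'a operator) \<Rightarrow> (nat \<Rightarrow> nat \<Rightarrow> 'a \<Rightarrow> 'a) \<Rightarrow> nat \<Rightarrow> nat \<Rightarrow> 'a operator" where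
  "B_conj B \<tau> j n = op_conj (\<tau> j n) (B j)"

definition L_op ::
  "nat \<Rightarrow> 'a::real_vector operator \<Rightarrow> (nat \<Rightarrow> 'a operator) \<Rightarrow> (nat \<Rightarrow> 'a operator) \<Rightarrow>
   (nat \<Rightarrow> nat \<Rightarrow> 'a \<Rightarrow> 'a) \<Rightarrow> nat \<Rightarrow> 'a operator" where
  "L_op N A B R \<tau> n = A +\<^sub>o op_sum (\<lambda>j. B_conj B \<tau> j n) {1..N} +\<^sub>o R n"

end

theory Submission
  imports Defs
begin

text \<open>
  Write \<open>T j = A + B j\<close>, and let the eigenvalue count of an operator at a
  level \<open>a\<close> be the total dimension of its eigenspaces for eigenvalues below \<open>a\<close>.  Everything follows
  from a comparison of counts: for \<open>a' < a \<le> \<delta>\<close> and all large \<open>n\<close>, the count of \<open>L n\<close> at \<open>a\<close> is at least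
  the sum of the counts of the \<open>T j\<close> at \<open>a\<close> (\<open>eventually_eigencount_ge\<close>), and the count of \<open>L n\<close> at
  \<open>a'\<close> is at most that sum (\<open>eventually_eigencount_le\<close>).  Choose \<open>\<kappa>\<close> in \<open>(0, \<delta>)\<close> such that no \<open>T j\<close> has an
  eigenvalue in \<open>[- \<kappa>, \<kappa>]\<close> apart from \<open>0\<close>.  The first inequality at \<open>- \<kappa>\<close> gives at least as many
  eigenvalues of \<open>L n\<close> below \<open>- \<kappa>\<close> as the \<open>T j\<close> have negative ones, the second one gives at most as
  many below \<open>\<kappa> / 2\<close> as the \<open>T j\<close> have nonpositive ones, and the kernel of \<open>L n\<close> is assumed to account
  for the whole difference.  Hence both inequalities are equalities, and \<open>L n\<close> has no other
  eigenvalue in \<open>[- \<kappa>, \<kappa> / 2)\<close>.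

  The first inequality is variational: the translated eigenvectors of the \<open>T j\<close> are asymptotically
  orthonormal, and \<open>L n\<close> acts on each of them asymptotically as the corresponding translated \<open>T j\<close>.

  The second inequality is a concentration-compactness argument.  If it failed, there would be unit
  vectors \<open>u n\<close> in the spectral subspace of \<open>L n\<close> below \<open>a'\<close>, orthogonal to all translated eigenvectors
  of the \<open>T j\<close> below \<open>a\<close>.  Their images under \<open>A\<close> are bounded, because relatively compact perturbations
  have relative bound zero (\<open>L_uniform_bounds\<close>).  Weak limits in the \<open>N\<close> moving frames split \<open>u n\<close> into
  translated profiles, on which \<open>T j\<close> is at least \<open>a\<close>, and a remainder that the compact maps
  \<open>B j \<circ> A\<^sup>-\<^sup>1\<close> do not see and on which \<open>A\<close> is asymptotically at least \<open>\<delta>\<close>.  Both mass and form decouple,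
  so the form of \<open>L n\<close> at \<open>u n\<close> is asymptotically at least \<open>a > a'\<close>, a contradiction.

  Both arguments use the spectral theorem only through \<open>form_bound_off_eigenframe\<close>: on the
  orthogonal complement of its eigenvectors below \<open>a\<close>, a self-adjoint operator with finitely many
  eigenvalues of finite multiplicity below \<open>\<delta> \<ge> a\<close> and no other spectrum there has form at least \<open>a\<close>.
  This is derived directly from bounds for resolvents.
\<close>

section \<open>Linear systems with more unknowns than equations\<close>

text \<open>
  All dimension comparisons below are reduced to this form, which applies verbatim to test vectors
  that are only asymptotically orthonormal.
\<close>

lemma underdetermined_system:
  fixes a :: "'i \<Rightarrow> 'w \<Rightarrow> real"
  assumes "finite W" "finite I" "card W < card I"
  shows "\<exists>c. (\<exists>i\<in>I. c i \<noteq> 0) \<and> (\<forall>w\<in>W. (\<Sum>i\<in>I. c i * a i w) = 0)"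
  using assms
proof (induction W arbitrary: I a rule: finite_induct)
  case empty
  then obtain i where "i \<in> I" by fastforce
  then show ?case by (intro exI[of _ "\<lambda>_. 1"]) auto
next
  case (insert w W)
  show ?case
  proof (cases "\<forall>i\<in>I. a i w = 0")
    case True
    have "card W < card I" using insert by simp
    from insert.IH[OF insert.prems(1) this, of a] obtain c where
      "\<exists>i\<in>I. c i \<noteq> 0" "\<forall>x\<in>W. (\<Sum>i\<in>I. c i * a i x) = 0" by blast
    moreover from True have "(\<Sum>i\<in>I. c i * a i w) = 0" by (simp add: sum.neutral)
    ultimately show ?thesis by blast
  next
    case False
    then obtain p where p: "p \<in> I" "a p w \<noteq> 0" by blast
    define b where "b i x = a i x - a i w / a p w * a p x" for i x
    have "card W < card (I - {p})" using insert p by simp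
    from insert.IH[OF _ this, of b] insert.prems obtain c where
      c: "\<exists>i\<in>I - {p}. c i \<noteq> 0" "\<And>x. x \<in> W \<Longrightarrow> (\<Sum>i\<in>I - {p}. c i * b i x) = 0" by auto
    define c' where "c' = c(p := - (\<Sum>i\<in>I - {p}. c i * (a i w / a p w)))"
    have eq: "(\<Sum>i\<in>I. c' i * a i x) = (\<Sum>i\<in>I - {p}. c i * b i x)" for x
    proof -
      have "(\<Sum>i\<in>I. c' i * a i x) = c' p * a p x + (\<Sum>i\<in>I - {p}. c' i * a i x)"
        using p insert.prems(1) by (simp add: sum.remove)
      also have "(\<Sum>i\<in>I - {p}. c' i * a i x) = (\<Sum>i\<in>I - {p}. c i * a i x)"
        by (rule sum.cong) (auto simp: c'_def)
      finally show ?thesis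
        by (simp add: b_def c'_def right_diff_distrib sum_subtractf sum_distrib_right mult.assoc)
    qed
    have "b i w = 0" for i using p by (simp add: b_def)
    then have "(\<Sum>i\<in>I. c' i * a i x) = 0" if "x \<in> insert w W" for x
      using c(2) that eq by auto
    moreover have "\<exists>i\<in>I. c' i \<noteq> 0" using c(1) by (auto simp: c'_def)
    ultimately show ?thesis by blast
  qed
qed


lemma nonneg_quadratic_discriminant:
  fixes p q r :: real
  assumes "\<And>t. 0 \<le> p + 2 * t * q + t\<^sup>2 * r" "r \<ge> 0"
  shows "q\<^sup>2 \<le> p * r"
proof (cases "r = 0")
  case True
  have "q = 0"
  proof (rule ccontr)
    assume "q \<noteq> 0"
    then have "2 * (- (p + 1) / (2 * q)) * q = - (p + 1)" by simp
    then show False using assms(1)[of "- (p + 1) / (2 * q)"] True by simp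
  qed
  then show ?thesis using True by simp
next
  case False
  then have r: "r > 0" using assms(2) by simp
  have "0 \<le> r * (p + 2 * (- q / r) * q + (- q / r)\<^sup>2 * r)"
    using assms(1)[of "- q / r"] r by (intro mult_nonneg_nonneg) auto
  also have "\<dots> = p * r - q\<^sup>2"
    using r by (simp add: field_simps power2_eq_square)
  finally show ?thesis by simp
qed


section \<open>Riesz representation and weak limits in a real Hilbert space\<close>

text \<open>
  The representing vector minimises \<open>\<lambda>x. (norm x)\<^sup>2 - 2 * f x\<close> over \<open>W\<close>; a minimising
  sequence is Cauchy by the parallelogram law.  With \<open>W = UNIV\<close> this is the Riesz theorem, and
  with \<open>f = (\<bullet>) v\<close> the vector found is the orthogonal projection of \<open>v\<close> onto \<open>W\<close>.
\<close>

lemma riesz_on_closed_subspace: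
  fixes f :: "'a::{real_inner, complete_space} \<Rightarrow> real"
  assumes f: "bounded_linear f" and W: "subspace W" "closed W"
  shows "\<exists>z\<in>W. \<forall>y\<in>W. f y = z \<bullet> y"
proof -
  interpret f: bounded_linear f by fact
  define J where "J x = (norm x)\<^sup>2 - 2 * f x" for x
  obtain K where K: "\<And>x. norm (f x) \<le> norm x * K" using f.bounded by blast
  have J_lower: "J x \<ge> - K\<^sup>2" for x
  proof -
    have "f x \<le> norm x * K" using K[of x] by simp
    moreover have "0 \<le> (norm x - K)\<^sup>2" by simp
    ultimately show ?thesis by (simp add: J_def power2_diff)
  qed
  define m where "m = Inf (J ` W)"
  have "0 \<in> W" using W by (simp add: subspace_0)
  have bdd: "bdd_below (J ` W)" using J_lower by (intro bdd_belowI2)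
  have m_le: "m \<le> J x" if "x \<in> W" for x
    unfolding m_def using bdd that by (rule cINF_lower)
  have ex: "\<exists>x\<in>W. J x < m + inverse (real (Suc n))" for n
    using cINF_less_iff[OF _ bdd, of "m + inverse (real (Suc n))"] \<open>0 \<in> W\<close>
    by (auto simp: m_def)
  then obtain x where x: "\<And>n. x n \<in> W" "\<And>n. J (x n) < m + inverse (real (Suc n))"
    by metis
  have close: "(norm (x p - x q))\<^sup>2 \<le> 2 * inverse (real (Suc p)) + 2 * inverse (real (Suc q))" for p q
  proof -
    have mid: "(1/2) *\<^sub>R (x p + x q) \<in> W" using x(1) W by (simp add: subspace_add subspace_scale)
    have "(norm (x p - x q))\<^sup>2 = 2 * J (x p) + 2 * J (x q) - 4 * J ((1/2) *\<^sub>R (x p + x q))"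
      by (simp add: J_def f.add f.scaleR power2_norm_eq_inner algebra_simps inner_commute)
    then show ?thesis using m_le[OF mid] x(2)[of p] x(2)[of q] by simp
  qed
  have "Cauchy x"
  proof (rule metric_CauchyI)
    fix e :: real assume "e > 0"
    then obtain M where M: "inverse (real (Suc M)) < e\<^sup>2 / 4"
      using reals_Archimedean[of "e\<^sup>2 / 4"] by auto
    have "dist (x p) (x q) < e" if "p \<ge> M" "q \<ge> M" for p q
    proof -
      have "inverse (real (Suc r)) \<le> inverse (real (Suc M))" if "r \<ge> M" for r
        using that by (intro le_imp_inverse_le) auto
      from this[of p] this[of q] have "(norm (x p - x q))\<^sup>2 < e\<^sup>2"
        using close[of p q] M that by linarith
      then show ?thesis using \<open>e > 0\<close> by (simp add: dist_norm power2_less_imp_less)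
    qed
    then show "\<exists>M. \<forall>p\<ge>M. \<forall>q\<ge>M. dist (x p) (x q) < e" by blast
  qed
  then obtain z where z: "x \<longlonglongrightarrow> z" using Cauchy_convergent convergent_def by blast
  have "z \<in> W" using closed_sequentially[OF W(2)] x(1) z by blast
  have "(\<lambda>n. J (x n)) \<longlonglongrightarrow> J z"
    unfolding J_def by (intro tendsto_intros z f.tendsto)
  moreover have "(\<lambda>n. m + inverse (real (Suc n))) \<longlonglongrightarrow> m"
    using tendsto_add[OF tendsto_const LIMSEQ_inverse_real_of_nat, of m] by simp
  ultimately have Jz: "J z \<le> m"
    by (rule LIMSEQ_le) (use x(2) less_imp_le in blast)
  have "f y = z \<bullet> y" if "y \<in> W" for y
  proof -
    define d where "d = z \<bullet> y - f y"
    have "0 \<le> 0 + 2 * t * d + t\<^sup>2 * (y \<bullet> y)" for t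
    proof -
      have "z + t *\<^sub>R y \<in> W" using that \<open>z \<in> W\<close> W by (simp add: subspace_add subspace_scale)
      then have "J z \<le> J (z + t *\<^sub>R y)" using Jz m_le by fastforce
      moreover have "J (z + t *\<^sub>R y) = J z + (2 * t * d + t\<^sup>2 * (y \<bullet> y))"
        unfolding J_def d_def f.add f.scaleR power2_norm_eq_inner
        by (simp add: inner_add_left inner_add_right inner_commute distrib_left right_diff_distrib
            power2_eq_square)
      ultimately show ?thesis by simp
    qed
    from nonneg_quadratic_discriminant[OF this] have "d = 0" by simp
    then show ?thesis by (simp add: d_def)
  qed
  then show ?thesis using \<open>z \<in> W\<close> by blast
qed

definition weak_tendsto :: "('i \<Rightarrow> 'a::real_inner) \<Rightarrow> 'a \<Rightarrow> 'i filter \<Rightarrow> bool" where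
  "weak_tendsto x z F \<longleftrightarrow> (\<forall>y. ((\<lambda>n. x n \<bullet> y) \<longlongrightarrow> z \<bullet> y) F)"

lemma weak_tendsto_mono: "weak_tendsto x z F \<Longrightarrow> F' \<le> F \<Longrightarrow> weak_tendsto x z F'"
  unfolding weak_tendsto_def by (meson tendsto_mono)

text \<open>
  Compactness is used through finer filters instead of subsequences: the space need not be
  separable, and one refinement serves arbitrarily many test vectors at once.
\<close>

lemma compact_refine_filter:
  assumes "compact S" "F \<noteq> bot" "\<And>n. g n \<in> S"
  shows "\<exists>F'\<le>F. F' \<noteq> bot \<and> (\<exists>z\<in>S. (g \<longlongrightarrow> z) F')"
proof -
  have "filtermap g F \<noteq> bot" using assms(2) by (simp add: filtermap_bot_iff)
  moreover have "eventually (\<lambda>x. x \<in> S) (filtermap g F)"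
    using assms(3) by (simp add: eventually_filtermap)
  ultimately obtain z where z: "z \<in> S" "inf (nhds z) (filtermap g F) \<noteq> bot"
    using assms(1) unfolding compact_filter by blast
  define F' where "F' = inf F (filtercomap g (nhds z))"
  have "F' \<noteq> bot"
  proof
    assume "F' = bot"
    then have "eventually (\<lambda>_. False) F'" by simp
    then obtain P Q where PQ: "eventually P F" "eventually Q (nhds z)" "\<And>n. P n \<Longrightarrow> Q (g n) \<Longrightarrow> False"
      unfolding F'_def eventually_inf eventually_filtercomap by metis
    have "eventually (\<lambda>y. \<not> Q y) (filtermap g F)"
      unfolding eventually_filtermap using PQ(1) by eventually_elim (use PQ(3) in blast)
    then have "eventually (\<lambda>_. False) (inf (nhds z) (filtermap g F))"
      using PQ(2) unfolding eventually_inf by blast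
    then show False using z(2) by (simp add: trivial_limit_def)
  qed
  moreover have "(g \<longlongrightarrow> z) F'"
    unfolding F'_def by (rule filterlim_mono[OF filterlim_filtercomap order_refl]) simp
  moreover have "F' \<le> F" by (simp add: F'_def)
  ultimately show ?thesis using z(1) by blast
qed

text \<open>
  By Tychonoff's theorem the coordinates \<open>x j n \<bullet> y\<close> converge simultaneously along a finer filter;
  the limits are bounded linear in \<open>y\<close>, so the Riesz theorem turns them into vectors.
\<close>

lemma bounded_weak_cluster:
  fixes x :: "'j \<Rightarrow> 'i \<Rightarrow> 'a::{real_inner, complete_space}"
  assumes F: "F \<noteq> bot" and bd: "\<And>j n. j \<in> J \<Longrightarrow> norm (x j n) \<le> C"
  shows "\<exists>F'\<le>F. F' \<noteq> bot \<and> (\<exists>z. \<forall>j\<in>J. weak_tendsto (x j) (z j) F')"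
proof -
  define g where "g n = (\<lambda>(j, y). if j \<in> J then x j n \<bullet> y else 0)" for n
  define S where "S = (PiE UNIV (\<lambda>(j::'j, y::'a). {- (\<bar>C\<bar> * norm y)..\<bar>C\<bar> * norm y}))"
  have "compactin (product_topology (\<lambda>i. euclidean) UNIV) S"
    unfolding S_def compactin_PiE by auto
  then have "compact S" by (simp add: euclidean_product_topology)
  moreover have "g n \<in> S" for n
  proof -
    have "\<bar>x j n \<bullet> y\<bar> \<le> \<bar>C\<bar> * norm y" if "j \<in> J" for j y
    proof -
      have "\<bar>x j n \<bullet> y\<bar> \<le> norm (x j n) * norm y" by (rule Cauchy_Schwarz_ineq2)
      also have "\<dots> \<le> \<bar>C\<bar> * norm y"
        using bd[OF that, of n] by (intro mult_right_mono) auto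
      finally show ?thesis .
    qed
    then have "x j n \<bullet> y \<le> \<bar>C\<bar> * norm y" "- (\<bar>C\<bar> * norm y) \<le> x j n \<bullet> y" if "j \<in> J" for j y
      using that by (simp_all add: abs_le_iff minus_le_iff)
    then show ?thesis by (auto simp: S_def g_def PiE_iff)
  qed
  ultimately obtain F' h where F': "F' \<le> F" "F' \<noteq> bot" and h: "(g \<longlongrightarrow> h) F'"
    using compact_refine_filter[OF _ F, of S g] by blast
  have coord: "((\<lambda>n. x j n \<bullet> y) \<longlongrightarrow> h (j, y)) F'" if "j \<in> J" for j y
  proof -
    have "continuous_on UNIV (\<lambda>f::'j \<times> 'a \<Rightarrow> real. f (j, y))"
      by (rule continuous_on_product_then_coordinatewise) (rule continuous_on_id)
    from continuous_on_tendsto_compose[OF this h]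
    have "((\<lambda>n. g n (j, y)) \<longlongrightarrow> h (j, y)) F'" by simp
    then show ?thesis using that by (simp add: g_def)
  qed
  have "\<exists>z. weak_tendsto (x j) z F'" if j: "j \<in> J" for j
  proof -
    have "bounded_linear (\<lambda>y. h (j, y))"
    proof (rule bounded_linear_intro)
      fix u v :: 'a and r :: real
      have "((\<lambda>n. x j n \<bullet> u + x j n \<bullet> v) \<longlongrightarrow> h (j, u) + h (j, v)) F'"
        by (intro tendsto_add coord j)
      then show "h (j, u + v) = h (j, u) + h (j, v)"
        using tendsto_unique[OF F'(2) coord[OF j, of "u + v"]] by (simp add: inner_add_right)
      have "((\<lambda>n. r * (x j n \<bullet> u)) \<longlongrightarrow> r * h (j, u)) F'"
        by (intro tendsto_mult tendsto_const coord j)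
      then show "h (j, r *\<^sub>R u) = r *\<^sub>R h (j, u)"
        using tendsto_unique[OF F'(2) coord[OF j, of "r *\<^sub>R u"]] by simp
      have "((\<lambda>n. \<bar>x j n \<bullet> u\<bar>) \<longlongrightarrow> \<bar>h (j, u)\<bar>) F'" by (intro tendsto_rabs coord j)
      moreover have "\<bar>x j n \<bullet> u\<bar> \<le> norm u * C" for n
      proof -
        have "\<bar>x j n \<bullet> u\<bar> \<le> norm (x j n) * norm u" by (rule Cauchy_Schwarz_ineq2)
        also have "\<dots> \<le> C * norm u" by (intro mult_right_mono bd[OF j]) simp
        finally show ?thesis by (simp add: mult.commute)
      qed
      ultimately show "norm (h (j, u)) \<le> norm u * C"
        by (simp add: tendsto_upperbound[OF _ _ F'(2)])
    qed
    from riesz_on_closed_subspace[OF this subspace_UNIV closed_UNIV]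
    obtain z where "\<And>y. h (j, y) = z \<bullet> y" by auto
    then show ?thesis using coord[OF j] by (auto simp: weak_tendsto_def)
  qed
  then show ?thesis using F' by meson
qed

lemma weak_tendsto_diff:
  assumes "weak_tendsto x a F" "weak_tendsto y b F"
  shows "weak_tendsto (\<lambda>n. x n - y n) (a - b) F"
  using assms unfolding weak_tendsto_def inner_diff_left by (auto intro: tendsto_diff)

lemma weak_tendsto_sum:
  assumes "\<And>j. j \<in> J \<Longrightarrow> weak_tendsto (x j) (a j) F"
  shows "weak_tendsto (\<lambda>n. \<Sum>j\<in>J. x j n) (\<Sum>j\<in>J. a j) F"
  using assms unfolding weak_tendsto_def inner_sum_left by (auto intro: tendsto_sum)

lemma weak_tendsto_const: "weak_tendsto (\<lambda>n. a) a F"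
  by (simp add: weak_tendsto_def)

lemma weak_null_from_dense:
  fixes x :: "'i \<Rightarrow> 'a::real_inner"
  assumes bd: "\<And>n. norm (x n) \<le> C" and D: "closure D = UNIV"
    and lim: "\<And>y. y \<in> D \<Longrightarrow> ((\<lambda>n. x n \<bullet> y) \<longlongrightarrow> 0) F"
  shows "weak_tendsto x 0 F"
  unfolding weak_tendsto_def inner_zero_left
proof (intro allI tendstoI)
  fix y and e :: real assume "e > 0"
  have C: "\<bar>C\<bar> + 1 > 0" by simp
  have "y \<in> closure D" using D by simp
  then obtain d where d: "d \<in> D" "dist d y < e / (2 * (\<bar>C\<bar> + 1))"
    unfolding closure_approachable using \<open>e > 0\<close> C by (meson divide_pos_pos mult_pos_pos zero_less_numeral)
  have "eventually (\<lambda>n. dist (x n \<bullet> d) 0 < e / 2) F"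
    by (rule tendstoD[OF lim[OF d(1)]]) (use \<open>e > 0\<close> in simp)
  then show "eventually (\<lambda>n. dist (x n \<bullet> y) 0 < e) F"
  proof eventually_elim
    case (elim n)
    have "\<bar>x n \<bullet> (y - d)\<bar> \<le> norm (x n) * norm (y - d)" by (rule Cauchy_Schwarz_ineq2)
    also have "\<dots> \<le> (\<bar>C\<bar> + 1) * norm (y - d)"
      using bd[of n] by (intro mult_right_mono) auto
    also have "\<dots> \<le> e / 2"
      using d(2) C by (simp add: dist_norm norm_minus_commute field_simps)
    finally have "\<bar>x n \<bullet> y - x n \<bullet> d\<bar> \<le> e / 2" by (simp add: inner_diff_right)
    moreover have "\<bar>x n \<bullet> d\<bar> < e / 2" using elim by (simp add: dist_real_def)
    ultimately show ?case unfolding dist_real_def by argo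
  qed
qed

definition compact_map :: "('a::real_normed_vector \<Rightarrow> 'a) \<Rightarrow> bool" where
  "compact_map K \<longleftrightarrow> linear K \<and> (\<forall>S. bounded S \<longrightarrow> compact (closure (K ` S)))"

lemma compact_map_bounded_linear:
  assumes "compact_map K"
  shows "bounded_linear K"
proof -
  interpret K: linear K using assms by (simp add: compact_map_def)
  have "bounded (K ` cball 0 1)"
    using assms bounded_cball unfolding compact_map_def
    by (meson bounded_subset closure_subset compact_imp_bounded)
  then obtain b where b: "\<And>x. norm x \<le> 1 \<Longrightarrow> norm (K x) \<le> b"
    unfolding bounded_iff by (metis imageI mem_cball_0)
  have "norm (K x) \<le> norm x * b" for x
  proof (cases "x = 0")
    case False
    have "norm (K ((1 / norm x) *\<^sub>R x)) \<le> b" by (rule b) (use False in simp)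
    then show ?thesis using False by (simp add: K.scaleR field_simps)
  qed (simp add: K.zero)
  then show ?thesis by (intro bounded_linear_intro[of K b] K.add K.scaleR)
qed

text \<open>
  The images of a weakly null family have only the weak limit \<open>0\<close> as possible cluster point, and
  compactness provides a cluster point as long as the images stay away from \<open>0\<close>.
\<close>

lemma compact_map_weak_null:
  fixes K :: "'a::{real_inner, complete_space} \<Rightarrow> 'a"
  assumes K: "compact_map K" and bd: "\<And>n. norm (x n) \<le> C" and x: "weak_tendsto x 0 F"
  shows "((\<lambda>n. K (x n)) \<longlongrightarrow> 0) F"
proof (rule ccontr)
  interpret K: bounded_linear K using K by (rule compact_map_bounded_linear)
  assume "\<not> ?thesis"
  then obtain e where e: "e > 0" "\<not> eventually (\<lambda>n. norm (K (x n)) < e) F"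
    by (auto simp: tendsto_iff)
  define F1 where "F1 = inf F (principal {n. e \<le> norm (K (x n))})"
  have "F1 \<noteq> bot"
    using e(2) by (auto simp: F1_def trivial_limit_def eventually_inf_principal not_le)
  moreover have "compact (closure (K ` cball 0 C))" using K by (simp add: compact_map_def)
  moreover have "K (x n) \<in> closure (K ` cball 0 C)" for n
    using bd[of n] by (intro subsetD[OF closure_subset]) auto
  ultimately obtain F2 z where F2: "F2 \<le> F1" "F2 \<noteq> bot" and z: "((\<lambda>n. K (x n)) \<longlongrightarrow> z) F2"
    using compact_refine_filter[of _ F1 "\<lambda>n. K (x n)"] by blast
  have "F2 \<le> F" using F2(1) by (simp add: F1_def)
  have "bounded_linear (\<lambda>y. K y \<bullet> z)"
    by (rule bounded_linear_compose[OF bounded_linear_inner_left K.bounded_linear_axioms])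
  from riesz_on_closed_subspace[OF this subspace_UNIV closed_UNIV]
  obtain w where w: "\<And>y. K y \<bullet> z = y \<bullet> w" by (auto simp: inner_commute)
  have "((\<lambda>n. K (x n) \<bullet> z) \<longlongrightarrow> 0) F2"
    using x \<open>F2 \<le> F\<close> unfolding w weak_tendsto_def inner_zero_left by (meson tendsto_mono)
  moreover have "((\<lambda>n. K (x n) \<bullet> z) \<longlongrightarrow> z \<bullet> z) F2"
    by (intro tendsto_inner z tendsto_const)
  ultimately have "z = 0" using tendsto_unique[OF F2(2)] by fastforce
  then have "eventually (\<lambda>n. norm (K (x n)) < e) F2" using z e(1) by (simp add: tendsto_iff)
  moreover have "eventually (\<lambda>n. e \<le> norm (K (x n))) F2"
    using F2(1) by (rule filter_leD) (simp add: F1_def eventually_inf_principal)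
  ultimately have "eventually (\<lambda>_. False) F2" by eventually_elim simp
  then show False using F2(2) by (simp add: trivial_limit_def)
qed


section \<open>Orthonormal families\<close>

definition orthonormal :: "'a::real_inner set \<Rightarrow> bool" where
  "orthonormal \<Phi> \<longleftrightarrow> (\<forall>f\<in>\<Phi>. f \<bullet> f = 1) \<and> (\<forall>f\<in>\<Phi>. \<forall>g\<in>\<Phi>. f \<noteq> g \<longrightarrow> f \<bullet> g = 0)"

lemma orthonormal_inner_sum:
  assumes "orthonormal \<Phi>" "finite \<Phi>" "g \<in> \<Phi>"
  shows "(\<Sum>f\<in>\<Phi>. c f *\<^sub>R f) \<bullet> g = c g"
proof -
  have "(\<Sum>f\<in>\<Phi>. c f *\<^sub>R f) \<bullet> g = (\<Sum>f\<in>\<Phi>. if f = g then c g else 0)"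
    unfolding inner_sum_left using assms by (intro sum.cong) (auto simp: orthonormal_def)
  then show ?thesis using assms by simp
qed

lemma orthonormal_inner_sum_sum:
  assumes "orthonormal \<Phi>" "finite \<Phi>"
  shows "(\<Sum>f\<in>\<Phi>. c f *\<^sub>R f) \<bullet> (\<Sum>f\<in>\<Phi>. d f *\<^sub>R f) = (\<Sum>f\<in>\<Phi>. c f * d f)"
  unfolding inner_sum_right by (rule sum.cong) (simp_all add: orthonormal_inner_sum[OF assms])

lemma orthonormal_basis_exists:
  fixes V :: "'a::real_inner set"
  assumes V: "subspace V" and S: "finite S" "V \<subseteq> span S"
  shows "\<exists>C. finite C \<and> orthonormal C \<and> span C = V \<and> card C = dim V"
proof -
  obtain B where B: "B \<subseteq> V" "independent B" "V \<subseteq> span B" "card B = dim V"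
    using basis_exists by blast
  have "finite B"
    using independent_span_bound[OF S(1) B(2)] B(1) S(2) by blast
  then obtain C where C: "finite C" "card C \<le> card B" "span C = span B" "pairwise orthogonal C"
    using basis_orthogonal by blast
  have spC: "span C = V" using B C V by (metis span_subspace)
  define C' where "C' = (\<lambda>x. x /\<^sub>R norm x) ` (C - {0})"
  have "finite C'" using C by (simp add: C'_def)
  have on: "orthonormal C'"
    using C(4) by (auto simp: orthonormal_def C'_def pairwise_def orthogonal_def
        power2_norm_eq_inner[symmetric] power2_eq_square)
  have sp: "span C' = V"
  proof
    have "C' \<subseteq> span C" by (auto simp: C'_def intro!: span_scale intro: span_base)
    then show "span C' \<subseteq> V" using spC span_minimal subspace_span by blast
    have "x \<in> span C'" if "x \<in> C" for x
    proof (cases "x = 0")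
      case False
      have "norm x *\<^sub>R (x /\<^sub>R norm x) \<in> span C'"
        using that False by (intro span_scale span_base) (auto simp: C'_def)
      then show ?thesis using False by simp
    qed (simp add: span_zero)
    then show "V \<subseteq> span C'" using spC span_minimal subspace_span by blast
  qed
  have "card C' \<le> card (C - {0})" unfolding C'_def using C(1) by (intro card_image_le) simp
  also have "\<dots> \<le> card C" using C(1) by (intro card_mono) auto
  finally have "card C' \<le> dim V" using C(2) B(4) by simp
  moreover have "dim V \<le> card C'" using sp \<open>finite C'\<close> by (intro dim_le_card) auto
  ultimately show ?thesis using on sp \<open>finite C'\<close> by auto
qed


lemma subspace_closure:
  fixes S :: "'a::real_normed_vector set"
  assumes "subspace S"
  shows "subspace (closure S)"
  unfolding subspace_def
proof (intro conjI ballI allI)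
  show "0 \<in> closure S" using closure_subset subspace_0[OF assms] by blast
next
  fix x y assume "x \<in> closure S" "y \<in> closure S"
  then obtain f g where "\<And>n. f n \<in> S" "f \<longlonglongrightarrow> x" "\<And>n. g n \<in> S" "g \<longlonglongrightarrow> y"
    unfolding closure_sequential by blast
  then show "x + y \<in> closure S"
    unfolding closure_sequential
    by (intro exI[of _ "\<lambda>n. f n + g n"]) (auto intro: tendsto_add subspace_add[OF assms])
next
  fix c x assume "x \<in> closure S"
  then obtain f where "\<And>n. f n \<in> S" "f \<longlonglongrightarrow> x" unfolding closure_sequential by blast
  then show "c *\<^sub>R x \<in> closure S"
    unfolding closure_sequential
    by (intro exI[of _ "\<lambda>n. c *\<^sub>R f n"]) (auto intro: tendsto_scaleR subspace_scale[OF assms])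
qed


section \<open>Self-adjoint operators and their resolvents\<close>

lemma orthogonal_to_dense:
  fixes w :: "'a::real_inner"
  assumes "closure D = UNIV" "\<And>u. u \<in> D \<Longrightarrow> u \<bullet> w = 0"
  shows "w = 0"
proof -
  have "closed {u. u \<bullet> w = 0}" by (intro closed_Collect_eq continuous_intros)
  then have "closure D \<subseteq> {u. u \<bullet> w = 0}" using assms(2) by (intro closure_minimal) auto
  then have "w \<bullet> w = 0" unfolding assms(1) by blast
  then show ?thesis by simp
qed

lemma resolvent_operator:
  fixes T :: "'a::real_normed_vector operator"
  assumes "\<mu> \<in> resolvent_set T"
  obtains G where "bounded_linear G" "\<And>x. G x \<in> Dom T" "\<And>x. app T (G x) - \<mu> *\<^sub>R G x = x"
    "\<And>u. u \<in> Dom T \<Longrightarrow> G (app T u - \<mu> *\<^sub>R u) = u"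
proof
  have Dom: "Dom (op_shift T \<mu>) = Dom T"
    and app: "app (op_shift T \<mu>) = (\<lambda>u. app T u - \<mu> *\<^sub>R u)"
    by (auto simp: op_shift_def op_plus_def everywhere_def)
  have inv: "op_invertible (op_shift T \<mu>)" using assms by (simp add: resolvent_set_def)
  then have bij: "bij_betw (\<lambda>u. app T u - \<mu> *\<^sub>R u) (Dom T) UNIV"
    by (simp add: op_invertible_def Dom app)
  let ?G = "inv_into (Dom T) (\<lambda>u. app T u - \<mu> *\<^sub>R u)"
  show "bounded_linear ?G"
    using inv by (simp add: op_invertible_def bounded_op_def op_inv_def Dom app)
  show "?G x \<in> Dom T" for x using bij by (metis UNIV_I bij_betw_def inv_into_into)
  show "app T (?G x) - \<mu> *\<^sub>R ?G x = x" for x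
    using f_inv_into_f[of x "\<lambda>u. app T u - \<mu> *\<^sub>R u" "Dom T"] bij by (simp add: bij_betw_def)
  show "?G (app T u - \<mu> *\<^sub>R u) = u" if "u \<in> Dom T" for u
    using inv_into_f_f[OF bij_betw_imp_inj_on[OF bij] that] by simp
qed

locale self_adjoint_operator =
  fixes T :: "'a::{real_inner, complete_space} operator"
  assumes self_adjoint: "self_adjoint T"
begin

lemma subspace_Dom: "subspace (Dom T)"
  and dense_Dom: "closure (Dom T) = UNIV"
  and app_add: "u \<in> Dom T \<Longrightarrow> v \<in> Dom T \<Longrightarrow> app T (u + v) = app T u + app T v"
  and app_scale: "u \<in> Dom T \<Longrightarrow> app T (c *\<^sub>R u) = c *\<^sub>R app T u"
  using self_adjoint by (auto simp: self_adjoint_def lin_op_def)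

lemmas Dom_add = subspace_add[OF subspace_Dom]
  and Dom_diff = subspace_diff[OF subspace_Dom]
  and Dom_scale = subspace_scale[OF subspace_Dom]
  and Dom_sum = subspace_sum[OF subspace_Dom]

lemma app_diff: "u \<in> Dom T \<Longrightarrow> v \<in> Dom T \<Longrightarrow> app T (u - v) = app T u - app T v"
  using app_add[of u "(-1) *\<^sub>R v"] app_scale[of v "-1"] Dom_scale[of v "-1"] by simp

lemma app_sum:
  assumes "finite I" "\<And>i. i \<in> I \<Longrightarrow> u i \<in> Dom T"
  shows "app T (\<Sum>i\<in>I. c i *\<^sub>R u i) = (\<Sum>i\<in>I. c i *\<^sub>R app T (u i))"
  using assms
proof (induction I rule: finite_induct)
  case empty
  have "0 \<in> Dom T" using subspace_Dom by (rule subspace_0)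
  from app_scale[OF this, of 0] show ?case by simp
next
  case (insert i I)
  have "(\<Sum>j\<in>I. c j *\<^sub>R u j) \<in> Dom T"
    using insert by (intro Dom_sum Dom_scale) auto
  then show ?case using insert by (simp add: app_add app_scale Dom_scale)
qed

lemma adjoint_characterization:
  assumes "\<And>u. u \<in> Dom T \<Longrightarrow> app T u \<bullet> v = u \<bullet> w"
  shows "v \<in> Dom T \<and> app T v = w"
proof -
  have eq: "adjoint_op T =\<^sub>o T" using self_adjoint by (simp add: self_adjoint_def)
  have v: "v \<in> Dom (adjoint_op T)" using assms by (auto simp: adjoint_op_def)
  have "app (adjoint_op T) v = w"
    unfolding adjoint_op_def operator.simps
  proof (rule the_equality)
    fix w' assume w': "\<forall>u\<in>Dom T. app T u \<bullet> v = u \<bullet> w'"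
    have "w' - w = 0"
      by (rule orthogonal_to_dense[OF dense_Dom]) (use assms w' in \<open>simp add: inner_diff_right\<close>)
    then show "w' = w" by simp
  qed (use assms in blast)
  then show ?thesis using eq v by (auto simp: op_eq_def)
qed

lemma symmetric:
  assumes u: "u \<in> Dom T" and v: "v \<in> Dom T"
  shows "app T u \<bullet> v = u \<bullet> app T v"
proof -
  have "v \<in> Dom (adjoint_op T)" using self_adjoint v by (simp add: self_adjoint_def op_eq_def)
  then obtain w where w: "\<And>u. u \<in> Dom T \<Longrightarrow> app T u \<bullet> v = u \<bullet> w" by (auto simp: adjoint_op_def)
  then have "app T v = w" using adjoint_characterization by blast
  then show ?thesis using w u by simp
qed

lemma eigenvalue_not_in_resolvent:
  assumes "eigenvalue T \<mu>"
  shows "\<mu> \<in> spectrum T"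
proof (rule ccontr)
  assume "\<mu> \<notin> spectrum T"
  then have "\<mu> \<in> resolvent_set T" by (simp add: spectrum_def)
  then obtain G where G: "\<And>u. u \<in> Dom T \<Longrightarrow> G (app T u - \<mu> *\<^sub>R u) = u" "bounded_linear G"
    by (rule resolvent_operator) blast
  obtain u where u: "u \<in> Dom T" "app T u = \<mu> *\<^sub>R u" "u \<noteq> 0"
    using assms by (auto simp: eigenvalue_def eigenspace_def)
  then have "G 0 = u" using G(1)[of u] by simp
  then show False using linear_simps(3)[OF G(2)] u(3) by simp
qed

end

lemma semidefinite_Cauchy_Schwarz:
  fixes P :: "'a::real_inner \<Rightarrow> 'a"
  assumes V: "subspace V"
    and add: "\<And>u v. u \<in> V \<Longrightarrow> v \<in> V \<Longrightarrow> P (u + v) = P u + P v"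
    and scale: "\<And>c u. u \<in> V \<Longrightarrow> P (c *\<^sub>R u) = c *\<^sub>R P u"
    and sym: "\<And>u v. u \<in> V \<Longrightarrow> v \<in> V \<Longrightarrow> P u \<bullet> v = u \<bullet> P v"
    and nonneg: "\<And>u. u \<in> V \<Longrightarrow> 0 \<le> P u \<bullet> u"
    and u: "u \<in> V" and v: "v \<in> V"
  shows "(P u \<bullet> v)\<^sup>2 \<le> (P u \<bullet> u) * (P v \<bullet> v)"
proof (rule nonneg_quadratic_discriminant)
  fix t :: real
  have tv: "t *\<^sub>R v \<in> V" using V v by (rule subspace_scale)
  have "0 \<le> P (u + t *\<^sub>R v) \<bullet> (u + t *\<^sub>R v)"
    using V u tv by (intro nonneg subspace_add)
  also have "P (u + t *\<^sub>R v) = P u + t *\<^sub>R P v" using u v tv by (simp add: add scale)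
  finally show "0 \<le> P u \<bullet> u + 2 * t * (P u \<bullet> v) + t\<^sup>2 * (P v \<bullet> v)"
    using sym[OF u v]
    by (simp add: inner_add_left inner_add_right inner_commute[of "P v" u] power2_eq_square
        distrib_left mult.assoc)
qed (rule nonneg[OF v])

text \<open>
  Testing a nonnegative symmetric form on a preimage turns a bound for the inverse into a lower
  bound for the form.  This replaces the statement that the bottom of the form of a self-adjoint
  operator belongs to its spectrum.
\<close>

lemma semidefinite_inverse_bound:
  fixes P :: "'a::real_inner \<Rightarrow> 'a"
  assumes "subspace V"
    and "\<And>u v. u \<in> V \<Longrightarrow> v \<in> V \<Longrightarrow> P (u + v) = P u + P v"
    and "\<And>c u. u \<in> V \<Longrightarrow> P (c *\<^sub>R u) = c *\<^sub>R P u"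
    and "\<And>u v. u \<in> V \<Longrightarrow> v \<in> V \<Longrightarrow> P u \<bullet> v = u \<bullet> P v"
    and nonneg: "\<And>u. u \<in> V \<Longrightarrow> 0 \<le> P u \<bullet> u"
    and u: "u \<in> V" and v: "v \<in> V" "P v = u" "norm v \<le> C * norm u"
  shows "u \<bullet> u \<le> C * (P u \<bullet> u)"
proof (cases "u = 0")
  case False
  have "(u \<bullet> u)\<^sup>2 = (P u \<bullet> v)\<^sup>2" using assms(4)[OF u v(1)] v(2) by simp
  also have "\<dots> \<le> (P u \<bullet> u) * (P v \<bullet> v)"
    by (rule semidefinite_Cauchy_Schwarz[OF assms(1-5) u v(1)])
  also have "\<dots> \<le> (P u \<bullet> u) * (C * (u \<bullet> u))"
  proof (rule mult_left_mono[OF _ nonneg[OF u]])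
    have "P v \<bullet> v \<le> norm u * norm v" unfolding v(2) by (rule norm_cauchy_schwarz)
    also have "\<dots> \<le> norm u * (C * norm u)" using v(3) by (intro mult_left_mono) auto
    also have "\<dots> = C * (u \<bullet> u)" by (simp add: dot_square_norm power2_eq_square)
    finally show "P v \<bullet> v \<le> C * (u \<bullet> u)" .
  qed
  finally have "(u \<bullet> u) * (u \<bullet> u) \<le> (u \<bullet> u) * (C * (P u \<bullet> u))"
    by (simp add: power2_eq_square mult_ac)
  then show ?thesis using False by simp
qed (use nonneg[OF u] v in simp)

context self_adjoint_operator
begin

text \<open>
  The resolvent \<open>H\<close> at \<open>c\<close> is symmetric, and \<open>h\<^sup>2 - H\<^sup>2\<close> with \<open>h = onorm H\<close> is nonnegative without
  being bounded below by a positive constant.  If \<open>1 / h < r\<close>, then \<open>c + 1 / h\<close> and \<open>c - 1 / h\<close> lie in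
  the resolvent set and \<open>h\<^sup>2 - H\<^sup>2\<close> has a bounded inverse, a contradiction.
\<close>

lemma spectral_gap_bound:
  assumes gap: "\<And>t. \<bar>t - c\<bar> < r \<Longrightarrow> t \<in> resolvent_set T" and "r > 0" and u: "u \<in> Dom T"
  shows "r * norm u \<le> norm (app T u - c *\<^sub>R u)"
proof -
  have "c \<in> resolvent_set T" using gap[of c] \<open>r > 0\<close> by simp
  then obtain H where H: "bounded_linear H" "\<And>x. H x \<in> Dom T" "\<And>x. app T (H x) - c *\<^sub>R H x = x"
    "\<And>u. u \<in> Dom T \<Longrightarrow> H (app T u - c *\<^sub>R u) = u" by (rule resolvent_operator) blast
  interpret H: bounded_linear H by (rule H)
  define h where "h = onorm H"
  have onorm_H: "norm (H x) \<le> h * norm x" for x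
    unfolding h_def by (rule onorm[OF H(1)])
  have sym: "H x \<bullet> y = x \<bullet> H y" for x y
  proof -
    have "H x \<bullet> y = H x \<bullet> app T (H y) - c * (H x \<bullet> H y)"
      using H(3)[of y] by (metis inner_diff_right inner_scaleR_right)
    also have "\<dots> = app T (H x) \<bullet> H y - c * (H x \<bullet> H y)"
      using symmetric[OF H(2) H(2)] by simp
    also have "\<dots> = x \<bullet> H y"
      using H(3)[of x] by (metis inner_diff_left inner_scaleR_left)
    finally show ?thesis .
  qed
  have "h \<le> 1 / r"
  proof (rule ccontr)
    assume "\<not> h \<le> 1 / r"
    then have "h > 1 / r" by simp
    moreover have "1 / r > 0" using \<open>r > 0\<close> by simp
    ultimately have "h > 0" by linarith
    define s where "s = 1 / h"
    have s: "s > 0" "s < r" "s * h = 1"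
      using \<open>h > 1 / r\<close> \<open>h > 0\<close> \<open>r > 0\<close> by (auto simp: s_def field_simps)
    have "c + s \<in> resolvent_set T" "c - s \<in> resolvent_set T" using gap s by auto
    then obtain G1 G2 where
      G1: "bounded_linear G1" "\<And>x. G1 x \<in> Dom T" "\<And>x. app T (G1 x) - (c + s) *\<^sub>R G1 x = x" and
      G2: "bounded_linear G2" "\<And>x. G2 x \<in> Dom T" "\<And>x. app T (G2 x) - (c - s) *\<^sub>R G2 x = x"
      by (metis resolvent_operator)
    \<comment> \<open>\<open>W\<close> inverts \<open>h\<^sup>2 - H\<^sup>2\<close>, because \<open>(T - c)\<^sup>2 - s\<^sup>2\<close> is the product of \<open>T - c - s\<close> and \<open>T - c + s\<close>.\<close>
    define W where "W x = s\<^sup>2 *\<^sub>R (x + s\<^sup>2 *\<^sub>R G2 (G1 x))" for x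
    have "bounded_linear W"
      unfolding W_def
      by (intro bounded_linear_const_scaleR bounded_linear_add bounded_linear_ident
          bounded_linear_compose[OF G2(1) G1(1)])
    then obtain C where C: "C > 0" "\<And>x. norm (W x) \<le> norm x * C"
      using bounded_linear.pos_bounded by blast
    define P where "P x = h\<^sup>2 *\<^sub>R x - H (H x)" for x
    have PW: "P (W x) = x" for x
    proof -
      let ?y = "G1 x" and ?z = "G2 (G1 x)"
      have Tz: "app T ?z - c *\<^sub>R ?z = ?y - s *\<^sub>R ?z" using G2(3)[of ?y] by (simp add: algebra_simps)
      have Ty: "app T ?y - c *\<^sub>R ?y = x + s *\<^sub>R ?y" using G1(3)[of x] by (simp add: algebra_simps)
      have "app T (?y - s *\<^sub>R ?z) - c *\<^sub>R (?y - s *\<^sub>R ?z)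
          = (app T ?y - c *\<^sub>R ?y) - s *\<^sub>R (app T ?z - c *\<^sub>R ?z)"
        using G1(2) G2(2) by (simp add: app_diff app_scale Dom_scale algebra_simps)
      also have "\<dots> = x + s\<^sup>2 *\<^sub>R ?z" unfolding Ty Tz by (simp add: algebra_simps power2_eq_square)
      finally have "H (x + s\<^sup>2 *\<^sub>R ?z) = ?y - s *\<^sub>R ?z"
        using H(4)[of "?y - s *\<^sub>R ?z"] G1(2) G2(2) by (simp add: Dom_diff Dom_scale)
      moreover have "H (?y - s *\<^sub>R ?z) = ?z" using H(4)[OF G2(2)[of ?y]] Tz by simp
      ultimately have "H (H (W x)) = s\<^sup>2 *\<^sub>R ?z" by (simp add: W_def H.scaleR)
      moreover have "h\<^sup>2 *\<^sub>R W x = x + s\<^sup>2 *\<^sub>R ?z"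
        using s(3) by (simp add: W_def power_mult_distrib[symmetric] mult.commute)
      ultimately show ?thesis by (simp add: P_def)
    qed
    have nonneg: "0 \<le> P x \<bullet> x" for x
    proof -
      have "P x \<bullet> x = (h * norm x)\<^sup>2 - (norm (H x))\<^sup>2"
        by (simp add: P_def inner_diff_left sym power_mult_distrib power2_norm_eq_inner)
      then show ?thesis using onorm_H[of x] by (simp add: power_mono)
    qed
    have "x \<bullet> x \<le> C * (P x \<bullet> x)" for x
      by (rule semidefinite_inverse_bound[where V = UNIV and v = "W x"])
        (use PW nonneg C(2) in \<open>auto simp: P_def H.add H.scaleR sym inner_diff_left inner_diff_right
            algebra_simps mult.commute\<close>)
    moreover have "P x \<bullet> x = h\<^sup>2 * (norm x)\<^sup>2 - (norm (H x))\<^sup>2" for x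
      by (simp add: P_def inner_diff_left sym power2_norm_eq_inner)
    ultimately have "(norm (H x))\<^sup>2 \<le> (h\<^sup>2 - 1 / C) * (norm x)\<^sup>2" for x
      using C(1) by (simp add: power2_norm_eq_inner field_simps)
    then have "(norm (H x))\<^sup>2 \<le> (sqrt (max 0 (h\<^sup>2 - 1 / C)) * norm x)\<^sup>2" for x
      by (simp add: power_mult_distrib) (meson max.cobounded2 mult_right_mono order_trans zero_le_power2)
    then have bound: "norm (H x) \<le> sqrt (max 0 (h\<^sup>2 - 1 / C)) * norm x" for x
      by (rule power2_le_imp_le) simp
    have "onorm H \<le> sqrt (max 0 (h\<^sup>2 - 1 / C))"
      by (rule onorm_bound) (simp, rule bound)
    then have le: "h \<le> sqrt (max 0 (h\<^sup>2 - 1 / C))" by (simp add: h_def)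
    have "h\<^sup>2 \<le> max 0 (h\<^sup>2 - 1 / C)"
      using power_mono[OF le, of 2] \<open>h > 0\<close> by simp
    then show False using \<open>h > 0\<close> C(1) by (simp add: le_max_iff_disj)
  qed
  moreover have "norm u \<le> h * norm (app T u - c *\<^sub>R u)" using onorm_H H(4)[OF u] by metis
  ultimately have "norm u \<le> 1 / r * norm (app T u - c *\<^sub>R u)"
    by (meson mult_right_mono norm_ge_zero order_trans)
  then show ?thesis using \<open>r > 0\<close> by (simp add: field_simps)
qed

text \<open>Let \<open>c\<close> tend to \<open>- \<infinity>\<close> in the gap bound with \<open>r = a - c\<close>.\<close>

lemma form_bound_below_spectrum:
  assumes "\<And>t. t < a \<Longrightarrow> t \<in> resolvent_set T" and u: "u \<in> Dom T"
  shows "a * (u \<bullet> u) \<le> app T u \<bullet> u"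
proof (rule ccontr)
  define d where "d = a * (u \<bullet> u) - app T u \<bullet> u"
  assume "\<not> ?thesis"
  then have "d > 0" by (simp add: d_def)
  have *: "2 * k * d \<le> app T u \<bullet> app T u" if "k > - a" for k
  proof -
    have "(a + k) * norm u \<le> norm (app T u - (- k) *\<^sub>R u)"
      by (rule spectral_gap_bound[OF _ _ u]) (use that assms(1) in auto)
    then have "((a + k) * norm u)\<^sup>2 \<le> (norm (app T u - (- k) *\<^sub>R u))\<^sup>2"
      using that by (intro power_mono) auto
    then have "(a + k)\<^sup>2 * (u \<bullet> u) \<le> app T u \<bullet> app T u + 2 * k * (app T u \<bullet> u) + k\<^sup>2 * (u \<bullet> u)"
      unfolding power_mult_distrib power2_norm_eq_inner
      by (simp add: inner_add_left inner_add_right inner_commute power2_eq_square algebra_simps)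
    moreover have "(a + k)\<^sup>2 * (u \<bullet> u) = a\<^sup>2 * (u \<bullet> u) + 2 * k * (a * (u \<bullet> u)) + k\<^sup>2 * (u \<bullet> u)"
      by (simp add: power2_eq_square algebra_simps)
    moreover have "0 \<le> a\<^sup>2 * (u \<bullet> u)" by simp
    ultimately show ?thesis unfolding d_def right_diff_distrib by linarith
  qed
  define k where "k = max (1 - a) (app T u \<bullet> app T u / d + 1)"
  have "app T u \<bullet> app T u / d + 1 \<le> k" "k > - a" by (auto simp: k_def)
  then have "app T u \<bullet> app T u + d \<le> k * d"
    using \<open>d > 0\<close> by (simp add: field_simps)
  moreover have "0 \<le> app T u \<bullet> app T u" by simp
  ultimately show False using *[OF \<open>k > - a\<close>] \<open>d > 0\<close> by (simp add: mult.assoc)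
qed

end


section \<open>Eigenframes and the counting function\<close>

text \<open>
  An eigenframe at level \<open>a\<close> is an orthonormal basis of the sum of all eigenspaces for eigenvalues
  below \<open>a\<close>; the eigenvalue of a frame vector \<open>f\<close> is \<open>app T f \<bullet> f\<close>.
\<close>

definition eigenframe :: "'a::real_inner operator \<Rightarrow> real \<Rightarrow> 'a set \<Rightarrow> bool" where
  "eigenframe T a \<Phi> \<longleftrightarrow> finite \<Phi> \<and> orthonormal \<Phi> \<and> \<Phi> \<subseteq> Dom T \<and>
     (\<forall>f\<in>\<Phi>. app T f = (app T f \<bullet> f) *\<^sub>R f \<and> app T f \<bullet> f < a) \<and>
     (\<forall>\<mu><a. eigenspace T \<mu> \<subseteq> span \<Phi>)"

definition eigencount :: "'a::real_vector operator \<Rightarrow> real \<Rightarrow> nat" where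
  "eigencount T a = (\<Sum>\<mu> | \<mu> < a \<and> eigenvalue T \<mu>. dim (eigenspace T \<mu>))"

context self_adjoint_operator
begin

lemma subspace_eigenspace: "subspace (eigenspace T \<mu>)"
  using app_scale[OF subspace_0[OF subspace_Dom], of 0]
  by (auto simp: subspace_def eigenspace_def app_add app_scale Dom_add Dom_scale
      subspace_0[OF subspace_Dom] scaleR_add_right)

lemma finite_eigenvalues_below:
  assumes "fin_discrete_below T \<delta>" "a \<le> \<delta>"
  shows "finite {\<mu>. \<mu> < a \<and> eigenvalue T \<mu>}"
proof (rule finite_subset)
  show "{\<mu>. \<mu> < a \<and> eigenvalue T \<mu>} \<subseteq> spectrum T \<inter> {..<\<delta>}"
    using eigenvalue_not_in_resolvent assms(2) by auto
qed (use assms(1) in \<open>simp add: fin_discrete_below_def\<close>)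

lemma eigenspace_finite_span:
  assumes "fin_discrete_below T \<delta>" "\<mu> < \<delta>"
  shows "\<exists>S. finite S \<and> eigenspace T \<mu> \<subseteq> span S"
proof (cases "eigenvalue T \<mu>")
  case True
  then show ?thesis
    using assms eigenvalue_not_in_resolvent by (auto simp: fin_discrete_below_def)
next
  case False
  then have "eigenspace T \<mu> \<subseteq> span {}" by (auto simp: eigenvalue_def)
  then show ?thesis by blast
qed

lemma eigenvectors_orthogonal:
  assumes "u \<in> eigenspace T \<mu>" "v \<in> eigenspace T \<nu>" "\<mu> \<noteq> \<nu>"
  shows "u \<bullet> v = 0"
proof -
  have "\<mu> * (u \<bullet> v) = \<nu> * (u \<bullet> v)"
    using symmetric[of u v] assms by (simp add: eigenspace_def)
  then show ?thesis using assms(3) by simp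
qed

lemma eigenframe_exists:
  assumes fin: "fin_discrete_below T \<delta>" and "a \<le> \<delta>"
  shows "\<exists>\<Phi>. eigenframe T a \<Phi> \<and> card \<Phi> = eigencount T a"
proof -
  define E where "E = {\<mu>. \<mu> < a \<and> eigenvalue T \<mu>}"
  have finE: "finite E" unfolding E_def by (rule finite_eigenvalues_below[OF assms])
  have "\<exists>C. finite C \<and> orthonormal C \<and> span C = eigenspace T \<mu> \<and> card C = dim (eigenspace T \<mu>)"
    if "\<mu> \<in> E" for \<mu>
    using eigenspace_finite_span[OF fin, of \<mu>] that \<open>a \<le> \<delta>\<close>
      orthonormal_basis_exists[OF subspace_eigenspace] by (fastforce simp: E_def)
  then obtain C where C: "\<And>\<mu>. \<mu> \<in> E \<Longrightarrow> finite (C \<mu>)" "\<And>\<mu>. \<mu> \<in> E \<Longrightarrow> orthonormal (C \<mu>)"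
    "\<And>\<mu>. \<mu> \<in> E \<Longrightarrow> span (C \<mu>) = eigenspace T \<mu>"
    "\<And>\<mu>. \<mu> \<in> E \<Longrightarrow> card (C \<mu>) = dim (eigenspace T \<mu>)" by metis
  have mem: "f \<in> eigenspace T \<mu>" if "\<mu> \<in> E" "f \<in> C \<mu>" for f \<mu>
    using C(3)[OF that(1)] that(2) span_base by blast
  have unit: "f \<bullet> f = 1" if "\<mu> \<in> E" "f \<in> C \<mu>" for f \<mu>
    using C(2)[OF that(1)] that(2) by (simp add: orthonormal_def)
  have orth: "f \<bullet> g = 0" if "\<mu> \<in> E" "f \<in> C \<mu>" "\<nu> \<in> E" "g \<in> C \<nu>" "f \<noteq> g" for f g \<mu> \<nu>
    using that C(2) eigenvectors_orthogonal[OF mem mem] by (cases "\<mu> = \<nu>") (auto simp: orthonormal_def)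
  have disj: "C \<mu> \<inter> C \<nu> = {}" if "\<mu> \<in> E" "\<nu> \<in> E" "\<mu> \<noteq> \<nu>" for \<mu> \<nu>
  proof (rule ccontr)
    assume "C \<mu> \<inter> C \<nu> \<noteq> {}"
    then obtain f where "f \<in> C \<mu>" "f \<in> C \<nu>" by blast
    then have "f \<bullet> f = 0" "f \<bullet> f = 1"
      using eigenvectors_orthogonal[OF mem mem that(3)] that unit by blast+
    then show False by simp
  qed
  define \<Phi> where "\<Phi> = (\<Union>\<mu>\<in>E. C \<mu>)"
  have "card \<Phi> = (\<Sum>\<mu>\<in>E. card (C \<mu>))"
    unfolding \<Phi>_def using finE C(1) disj by (intro card_UN_disjoint) auto
  then have "card \<Phi> = eigencount T a" using C(4) by (simp add: eigencount_def E_def)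
  moreover have "eigenframe T a \<Phi>"
    unfolding eigenframe_def
  proof (intro conjI ballI allI impI)
    show "finite \<Phi>" using finE C(1) by (simp add: \<Phi>_def)
    show "orthonormal \<Phi>" using unit orth by (auto simp: orthonormal_def \<Phi>_def)
    show "\<Phi> \<subseteq> Dom T" using mem by (auto simp: \<Phi>_def eigenspace_def)
    show "app T f = (app T f \<bullet> f) *\<^sub>R f" "app T f \<bullet> f < a" if f: "f \<in> \<Phi>" for f
    proof -
      obtain \<mu> where \<mu>: "\<mu> \<in> E" "f \<in> C \<mu>" using f by (auto simp: \<Phi>_def)
      then have "app T f = \<mu> *\<^sub>R f" using mem by (simp add: eigenspace_def)
      then show "app T f = (app T f \<bullet> f) *\<^sub>R f" "app T f \<bullet> f < a"
        using unit[OF \<mu>] \<mu>(1) by (simp_all add: E_def)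
    qed
    show "eigenspace T \<mu> \<subseteq> span \<Phi>" if "\<mu> < a" for \<mu>
    proof (cases "eigenvalue T \<mu>")
      case True
      then have "\<mu> \<in> E" using that by (simp add: E_def)
      then show ?thesis using C(3)[of \<mu>] span_mono[of "C \<mu>" \<Phi>] by (auto simp: \<Phi>_def)
    next
      case False
      then show ?thesis by (auto simp: eigenvalue_def span_zero)
    qed
  qed
  ultimately show ?thesis by blast
qed

end

lemma eigenframeD:
  assumes "eigenframe T a \<Phi>"
  shows "finite \<Phi>" "orthonormal \<Phi>" "\<And>f. f \<in> \<Phi> \<Longrightarrow> f \<in> Dom T"
    "\<And>f. f \<in> \<Phi> \<Longrightarrow> app T f = (app T f \<bullet> f) *\<^sub>R f" "\<And>f. f \<in> \<Phi> \<Longrightarrow> app T f \<bullet> f < a"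
    "\<And>\<mu>. \<mu> < a \<Longrightarrow> eigenspace T \<mu> \<subseteq> span \<Phi>"
  using assms unfolding eigenframe_def by blast+

context self_adjoint_operator
begin

text \<open>
  Let \<open>m\<close> be the infimum of the form over the unit vectors of the domain orthogonal to the frame,
  and suppose \<open>m < a\<close>.  If \<open>m\<close> is in the resolvent set, a bounded inverse of \<open>T - m\<close> pushes the
  infimum up.  Otherwise \<open>m\<close> is isolated in the spectrum, so the gap \<open>(m, b)\<close> above it gives
  \<open>(b - m) * ((T - m) u \<bullet> u) \<le> (norm ((T - m) u))\<^sup>2\<close>; as \<open>T - m\<close> has dense range in the
  orthogonal complement of the frame, Cauchy-Schwarz for the form of \<open>T - m\<close> again pushes the
  infimum up, by \<open>b - m\<close>.
\<close>

theorem form_bound_off_eigenframe: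
  assumes fin: "fin_discrete_below T \<delta>" and a: "a \<le> \<delta>" and frame: "eigenframe T a \<Phi>"
    and u0: "u\<^sub>0 \<in> Dom T" "\<And>f. f \<in> \<Phi> \<Longrightarrow> u\<^sub>0 \<bullet> f = 0"
  shows "a * (u\<^sub>0 \<bullet> u\<^sub>0) \<le> app T u\<^sub>0 \<bullet> u\<^sub>0"
proof (rule ccontr)
  assume contra: "\<not> ?thesis"
  note \<Phi> = eigenframeD[OF frame]
  define \<sigma> where "\<sigma> = spectrum T \<inter> {..<\<delta>}"
  have fin\<sigma>: "finite \<sigma>" using fin by (simp add: \<sigma>_def fin_discrete_below_def)
  have \<rho>: "t \<in> resolvent_set T" if "t < \<delta>" "t \<notin> \<sigma>" for t using that by (simp add: \<sigma>_def spectrum_def)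
  define M where "M = {u. \<forall>f\<in>\<Phi>. u \<bullet> f = 0}"
  have M: "subspace M" by (auto simp: M_def subspace_def inner_add_left)
  have closedM: "closed M"
  proof -
    have "M = (\<Inter>f\<in>\<Phi>. {u. u \<bullet> f = 0})" by (auto simp: M_def)
    then show ?thesis by (auto intro!: closed_INT closed_Collect_eq continuous_intros)
  qed
  have Minus_sub: "u - v \<in> M" if "u \<in> M" "v \<in> M" for u v using M that by (rule subspace_diff)
  have T_M: "app T u \<in> M" if "u \<in> M" "u \<in> Dom T" for u
  proof -
    have "app T u \<bullet> f = 0" if f: "f \<in> \<Phi>" for f
    proof -
      have "app T u \<bullet> f = u \<bullet> app T f" by (rule symmetric[OF \<open>u \<in> Dom T\<close> \<Phi>(3)[OF f]])
      also have "\<dots> = (app T f \<bullet> f) * (u \<bullet> f)" by (subst \<Phi>(4)[OF f]) simp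
      finally show ?thesis using \<open>u \<in> M\<close> f by (simp add: M_def)
    qed
    then show ?thesis by (simp add: M_def)
  qed
  define V where "V = M \<inter> Dom T"
  have V: "subspace V" unfolding V_def using M subspace_Dom by (rule subspace_inter)
  have u0V: "u\<^sub>0 \<in> V" using u0 by (simp add: V_def M_def)
  have u0_neq: "u\<^sub>0 \<noteq> 0" using contra by auto
  define S where "S = (\<lambda>u. app T u \<bullet> u) ` {u \<in> V. u \<bullet> u = 1}"
  have scaled: "(1 / norm u) *\<^sub>R u \<in> {u \<in> V. u \<bullet> u = 1}"
    "app T ((1 / norm u) *\<^sub>R u) \<bullet> ((1 / norm u) *\<^sub>R u) = (app T u \<bullet> u) / (u \<bullet> u)"
    if "u \<in> V" "u \<noteq> 0" for u
  proof -
    show "(1 / norm u) *\<^sub>R u \<in> {u \<in> V. u \<bullet> u = 1}"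
      using subspace_scale[OF V that(1)] that(2) by (simp add: dot_square_norm power2_eq_square)
    show "app T ((1 / norm u) *\<^sub>R u) \<bullet> ((1 / norm u) *\<^sub>R u) = (app T u \<bullet> u) / (u \<bullet> u)"
      using that by (simp add: V_def app_scale dot_square_norm power2_eq_square)
  qed
  have "bdd_below S"
  proof -
    define \<beta> where "\<beta> = Min (insert \<delta> \<sigma>)"
    have "t \<in> resolvent_set T" if "t < \<beta>" for t
      using that fin\<sigma> by (intro \<rho>) (auto simp: \<beta>_def)
    then have "\<beta> * (u \<bullet> u) \<le> app T u \<bullet> u" if "u \<in> Dom T" for u
      using form_bound_below_spectrum that by blast
    then show ?thesis unfolding S_def V_def by (intro bdd_belowI2[where m = \<beta>]) fastforce
  qed
  define m where "m = Inf S"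
  have "S \<noteq> {}" using scaled(1)[OF u0V u0_neq] by (auto simp: S_def)
  have form_m: "m * (u \<bullet> u) \<le> app T u \<bullet> u" if "u \<in> V" for u
  proof (cases "u = 0")
    case False
    have "(app T u \<bullet> u) / (u \<bullet> u) \<in> S"
      unfolding scaled(2)[OF that False, symmetric] S_def using scaled(1)[OF that False]
      by (rule imageI)
    then have "m \<le> (app T u \<bullet> u) / (u \<bullet> u)"
      unfolding m_def using \<open>bdd_below S\<close> by (rule cInf_lower)
    then show ?thesis using False by (simp add: field_simps)
  qed simp
  have sharp: False if "\<epsilon> > 0" "\<And>u. u \<in> V \<Longrightarrow> \<epsilon> * (u \<bullet> u) \<le> (app T u - m *\<^sub>R u) \<bullet> u" for \<epsilon>
  proof -
    have "m + \<epsilon> \<le> s" if "s \<in> S" for s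
      using that \<open>\<And>u. u \<in> V \<Longrightarrow> \<epsilon> * (u \<bullet> u) \<le> (app T u - m *\<^sub>R u) \<bullet> u\<close>
      by (fastforce simp: S_def inner_diff_left)
    then have "m + \<epsilon> \<le> m" unfolding m_def using \<open>S \<noteq> {}\<close> by (intro cInf_greatest)
    then show False using \<open>\<epsilon> > 0\<close> by simp
  qed
  have "m < a"
  proof -
    have "m * (u\<^sub>0 \<bullet> u\<^sub>0) < a * (u\<^sub>0 \<bullet> u\<^sub>0)" using form_m[OF u0V] contra by simp
    then show ?thesis using u0_neq by (simp add: mult_less_cancel_right)
  qed
  define P where "P u = app T u - m *\<^sub>R u" for u
  have P_add: "P (u + v) = P u + P v" if "u \<in> V" "v \<in> V" for u v
    using that by (simp add: P_def V_def app_add algebra_simps)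
  have P_scale: "P (c *\<^sub>R u) = c *\<^sub>R P u" if "u \<in> V" for c u
    using that by (simp add: P_def V_def app_scale algebra_simps)
  have P_sym: "P u \<bullet> v = u \<bullet> P v" if "u \<in> Dom T" "v \<in> Dom T" for u v
    using symmetric[OF that] by (simp add: P_def inner_diff_left inner_diff_right)
  have P_symV: "P u \<bullet> v = u \<bullet> P v" if "u \<in> V" "v \<in> V" for u v
    using that P_sym by (simp add: V_def)
  have P_nonneg: "0 \<le> P u \<bullet> u" if "u \<in> V" for u
    using form_m[OF that] by (simp add: P_def inner_diff_left)
  have P_M: "P u \<in> M" if "u \<in> V" for u
    unfolding P_def using that T_M M by (intro Minus_sub subspace_scale) (auto simp: V_def)
  show False
  proof (cases "m \<in> resolvent_set T")
    case True
    then obtain G where G: "bounded_linear G" "\<And>x. G x \<in> Dom T" "\<And>x. P (G x) = x"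
      unfolding P_def by (rule resolvent_operator) blast
    obtain C where C: "C > 0" "\<And>x. norm (G x) \<le> norm x * C"
      using bounded_linear.pos_bounded[OF G(1)] by blast
    have GV: "G x \<in> V" if "x \<in> V" for x
    proof -
      have "G x \<bullet> f = 0" if f: "f \<in> \<Phi>" for f
      proof -
        have "0 = P (G x) \<bullet> f" using \<open>x \<in> V\<close> f G(3) by (simp add: V_def M_def)
        also have "\<dots> = G x \<bullet> P f" by (rule P_sym[OF G(2) \<Phi>(3)[OF f]])
        also have "P f = (app T f \<bullet> f - m) *\<^sub>R f"
          unfolding P_def by (subst \<Phi>(4)[OF f]) (simp add: algebra_simps)
        finally have "(app T f \<bullet> f - m) * (G x \<bullet> f) = 0" by simp
        moreover have "app T f \<bullet> f \<noteq> m"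
        proof
          assume eq: "app T f \<bullet> f = m"
          then have "eigenvalue T m"
            using \<Phi>(2,3,4) f unfolding eigenvalue_def eigenspace_def orthonormal_def
            by (metis (mono_tags, lifting) inner_zero_left mem_Collect_eq zero_neq_one)
          then show False using True eigenvalue_not_in_resolvent by (auto simp: spectrum_def)
        qed
        ultimately show ?thesis by simp
      qed
      then show ?thesis using G(2) by (simp add: V_def M_def)
    qed
    have "x \<bullet> x \<le> C * (P x \<bullet> x)" if "x \<in> V" for x
      by (rule semidefinite_inverse_bound[OF V P_add P_scale P_symV P_nonneg that GV[OF that]])
        (use G(3) C(2)[of x] in \<open>auto simp: mult.commute\<close>)
    with sharp[of "1 / C"] show False
      using C(1) by (simp add: P_def field_simps)
  next
    case False
    define b where "b = Min (insert \<delta> {t \<in> \<sigma>. m < t})"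
    have "m < b" using fin\<sigma> \<open>m < a\<close> a by (simp add: b_def)
    have gap: "t \<in> resolvent_set T" if "m < t" "t < b" for t
      using that fin\<sigma> by (intro \<rho>) (auto simp: b_def)
    have P_gap: "(b - m) * (P u \<bullet> u) \<le> P u \<bullet> P u" if "u \<in> Dom T" for u
    proof -
      define r where "r = (b - m) / 2"
      have r: "r > 0" "2 * r = b - m" using \<open>m < b\<close> by (simp_all add: r_def)
      have "r * norm u \<le> norm (app T u - (m + r) *\<^sub>R u)"
        by (rule spectral_gap_bound[OF _ r(1) that]) (use r(2) gap in \<open>auto simp: abs_less_iff\<close>)
      then have "(r * norm u)\<^sup>2 \<le> (norm (P u - r *\<^sub>R u))\<^sup>2"
        using r(1) by (intro power_mono) (auto simp: P_def algebra_simps)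
      then have "r\<^sup>2 * (u \<bullet> u) \<le> P u \<bullet> P u - 2 * r * (P u \<bullet> u) + r\<^sup>2 * (u \<bullet> u)"
        unfolding power_mult_distrib power2_norm_eq_inner
        by (simp add: inner_diff_left inner_diff_right inner_commute power2_eq_square algebra_simps)
      then show ?thesis using r(2) by simp
    qed
    \<comment> \<open>The range of \<open>P\<close> on \<open>V\<close> is dense in \<open>V\<close>: the part \<open>q\<close> of a vector orthogonal to that range is an
      eigenvector for \<open>m < a\<close>, hence in the span of the frame, and orthogonal to the frame.\<close>
    define W where "W = closure (P ` V)"
    have "subspace (P ` V)"
    proof -
      have "P 0 = 0" using P_scale[OF u0V, of 0] by simp
      then have "0 \<in> P ` V" using subspace_0[OF V] by (intro image_eqI[of _ _ 0]) auto
      moreover have "P u + P v \<in> P ` V" if "u \<in> V" "v \<in> V" for u v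
        using that P_add[OF that] subspace_add[OF V that] by (intro image_eqI[of _ _ "u + v"]) auto
      moreover have "c *\<^sub>R P u \<in> P ` V" if "u \<in> V" for u c
        using that P_scale[OF that] subspace_scale[OF V that] by (intro image_eqI[of _ _ "c *\<^sub>R u"]) auto
      ultimately show ?thesis by (auto simp: subspace_def)
    qed
    then have W: "subspace W" "closed W"
      by (auto simp: W_def subspace_closure)
    have "W \<subseteq> M"
      unfolding W_def using P_M closedM by (intro closure_minimal) auto
    have "V \<subseteq> W"
    proof
      fix v assume v: "v \<in> V"
      from riesz_on_closed_subspace[OF bounded_linear_inner_right[of v] W]
      obtain p where p: "p \<in> W" "\<And>y. y \<in> W \<Longrightarrow> v \<bullet> y = p \<bullet> y" by blast
      define q where "q = v - p"
      have qM: "q \<in> M" unfolding q_def using v p(1) \<open>W \<subseteq> M\<close> by (intro Minus_sub) (auto simp: V_def)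
      have qV: "P d \<bullet> q = 0" if "d \<in> V" for d
      proof -
        have "P d \<in> W" unfolding W_def by (rule subsetD[OF closure_subset imageI[OF that]])
        from p(2)[OF this] show ?thesis
          by (simp add: q_def inner_diff_right inner_commute[of "P d"])
      qed
      have "app T d \<bullet> q = d \<bullet> (m *\<^sub>R q)" if d: "d \<in> Dom T" for d
      proof -
        define e where "e = (\<Sum>f\<in>\<Phi>. (d \<bullet> f) *\<^sub>R f)"
        have eD: "e \<in> Dom T" unfolding e_def using \<Phi>(3) by (intro Dom_sum Dom_scale)
        have "d - e \<in> V"
          using d eD orthonormal_inner_sum[OF \<Phi>(2,1)]
          by (simp add: V_def M_def Dom_diff inner_diff_left e_def)
        then have "P (d - e) \<bullet> q = 0" by (rule qV)
        moreover have "P e \<bullet> q = 0"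
        proof -
          have "P f \<bullet> q = 0" if "f \<in> \<Phi>" for f
          proof -
            have "P f = (app T f \<bullet> f - m) *\<^sub>R f"
              unfolding P_def by (subst \<Phi>(4)[OF that]) (simp add: algebra_simps)
            then show ?thesis using qM that by (simp add: M_def inner_commute)
          qed
          moreover have "P e = (\<Sum>f\<in>\<Phi>. (d \<bullet> f) *\<^sub>R P f)"
            unfolding P_def e_def using \<Phi>(1,3)
            by (simp add: app_sum scaleR_sum_right scaleR_diff_right sum_subtractf mult.commute)
          ultimately show ?thesis by (simp add: inner_sum_left)
        qed
        moreover have "P d = P (d - e) + P e"
          using d eD by (simp add: P_def app_diff algebra_simps)
        ultimately have "P d \<bullet> q = 0" by (simp add: inner_add_left)
        then show ?thesis by (simp add: P_def inner_diff_left)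
      qed
      from adjoint_characterization[OF this] have "q \<in> eigenspace T m"
        by (simp add: eigenspace_def)
      then have "q \<in> span \<Phi>" using \<Phi>(6)[OF \<open>m < a\<close>] by blast
      moreover have "\<Phi> \<subseteq> {f. q \<bullet> f = 0}" "subspace {f. q \<bullet> f = 0}"
        using qM by (auto simp: M_def subspace_def inner_add_right)
      ultimately have "q \<bullet> q = 0" using span_minimal by blast
      then show "v \<in> W" using p(1) by (simp add: q_def)
    qed
    have "(b - m) * (v \<bullet> v) \<le> P v \<bullet> v" if v: "v \<in> V" for v
    proof -
      define Z where "Z = {w. (b - m) * (w \<bullet> v)\<^sup>2 \<le> (w \<bullet> w) * (P v \<bullet> v)}"
      have "closed Z" unfolding Z_def by (intro closed_Collect_le continuous_intros)
      moreover have "P u \<in> Z" if u: "u \<in> V" for u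
      proof -
        have "(P u \<bullet> v)\<^sup>2 \<le> (P u \<bullet> u) * (P v \<bullet> v)"
          by (rule semidefinite_Cauchy_Schwarz[OF V P_add P_scale P_symV P_nonneg u v])
        then have "(b - m) * (P u \<bullet> v)\<^sup>2 \<le> (b - m) * ((P u \<bullet> u) * (P v \<bullet> v))"
          using \<open>m < b\<close> by (intro mult_left_mono) auto
        also have "\<dots> = ((b - m) * (P u \<bullet> u)) * (P v \<bullet> v)" by (simp add: mult.assoc)
        also have "\<dots> \<le> (P u \<bullet> P u) * (P v \<bullet> v)"
          using u by (intro mult_right_mono P_gap P_nonneg v) (simp add: V_def)
        finally show ?thesis by (simp add: Z_def)
      qed
      ultimately have "W \<subseteq> Z" unfolding W_def by (intro closure_minimal) auto
      then have "v \<in> Z" using v \<open>V \<subseteq> W\<close> by blast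
      then have *: "(v \<bullet> v) * ((b - m) * (v \<bullet> v)) \<le> (v \<bullet> v) * (P v \<bullet> v)"
        by (simp add: Z_def power2_eq_square mult_ac)
      show ?thesis
      proof (cases "v = 0")
        case False
        then have "v \<bullet> v > 0" by simp
        then show ?thesis using * by (simp only: mult_le_cancel_left_pos)
      qed (use P_nonneg[OF v] in simp)
    qed
    then show False
      using sharp[of "b - m"] \<open>m < b\<close> by (simp add: P_def)
  qed
qed

lemma app_eigenframe_sum:
  assumes "eigenframe T a \<Phi>"
  shows "app T (\<Sum>f\<in>\<Phi>. c f *\<^sub>R f) = (\<Sum>f\<in>\<Phi>. (c f * (app T f \<bullet> f)) *\<^sub>R f)"
proof -
  note \<Phi> = eigenframeD[OF assms]
  have "app T (\<Sum>f\<in>\<Phi>. c f *\<^sub>R f) = (\<Sum>f\<in>\<Phi>. c f *\<^sub>R app T f)" by (rule app_sum[OF \<Phi>(1,3)])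
  also have "\<dots> = (\<Sum>f\<in>\<Phi>. (c f * (app T f \<bullet> f)) *\<^sub>R f)"
    by (rule sum.cong) (simp_all flip: \<Phi>(4) scaleR_scaleR)
  finally show ?thesis .
qed

lemma form_bound_with_eigenframe:
  assumes "fin_discrete_below T \<delta>" "a \<le> \<delta>" and frame: "eigenframe T a \<Phi>" and u: "u \<in> Dom T"
  shows "a * (u \<bullet> u) + (\<Sum>f\<in>\<Phi>. (app T f \<bullet> f - a) * (u \<bullet> f)\<^sup>2) \<le> app T u \<bullet> u"
proof -
  note \<Phi> = eigenframeD[OF frame]
  define p where "p = (\<Sum>f\<in>\<Phi>. (u \<bullet> f) *\<^sub>R f)"
  define v where "v = u - p"
  have p: "p \<in> Dom T" unfolding p_def using \<Phi>(3) by (intro Dom_sum Dom_scale)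
  have v: "v \<in> Dom T" unfolding v_def using u p by (rule Dom_diff)
  have vf: "v \<bullet> f = 0" if "f \<in> \<Phi>" for f
    using orthonormal_inner_sum[OF \<Phi>(2,1) that] by (simp add: v_def p_def inner_diff_left)
  have vp: "v \<bullet> p = 0" by (simp add: p_def inner_sum_right vf)
  have Tp: "app T p = (\<Sum>f\<in>\<Phi>. ((u \<bullet> f) * (app T f \<bullet> f)) *\<^sub>R f)"
    unfolding p_def by (rule app_eigenframe_sum[OF frame])
  have vTp: "v \<bullet> app T p = 0" by (simp add: Tp inner_sum_right vf)
  have pTp: "app T p \<bullet> p = (\<Sum>f\<in>\<Phi>. (app T f \<bullet> f) * (u \<bullet> f)\<^sup>2)"
    unfolding Tp unfolding p_def orthonormal_inner_sum_sum[OF \<Phi>(2,1)]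
    by (simp add: power2_eq_square mult_ac)
  have pp: "p \<bullet> p = (\<Sum>f\<in>\<Phi>. (u \<bullet> f)\<^sup>2)"
    unfolding p_def orthonormal_inner_sum_sum[OF \<Phi>(2,1)] by (simp add: power2_eq_square)
  have u_eq: "u = v + p" by (simp add: v_def)
  have uu: "u \<bullet> u = v \<bullet> v + p \<bullet> p"
    using vp by (simp add: u_eq inner_add_left inner_add_right inner_commute)
  have "app T u \<bullet> u = app T v \<bullet> v + app T p \<bullet> p"
    using symmetric[OF v p] vTp v p
    by (simp add: u_eq app_add inner_add_left inner_add_right inner_commute[of _ v])
  also have "\<dots> \<ge> a * (v \<bullet> v) + app T p \<bullet> p"
    using form_bound_off_eigenframe[OF assms(1-3) v vf] by simp
  moreover have "a * (u \<bullet> u) + (\<Sum>f\<in>\<Phi>. (app T f \<bullet> f - a) * (u \<bullet> f)\<^sup>2) = a * (v \<bullet> v) + app T p \<bullet> p"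
    by (simp add: uu pp pTp left_diff_distrib sum_subtractf sum_distrib_left[symmetric] distrib_left)
  ultimately show ?thesis by simp
qed

lemma form_bounded_below:
  assumes "fin_discrete_below T \<delta>"
  obtains M where "M \<ge> 0" "\<And>u. u \<in> Dom T \<Longrightarrow> - M * (u \<bullet> u) \<le> app T u \<bullet> u"
proof -
  obtain \<Phi> where frame: "eigenframe T \<delta> \<Phi>" using eigenframe_exists[OF assms order_refl] by blast
  note \<Phi> = eigenframeD[OF frame]
  define M where "M = \<bar>\<delta>\<bar> + (\<Sum>f\<in>\<Phi>. \<delta> - app T f \<bullet> f)"
  have nonneg: "0 \<le> \<delta> - app T f \<bullet> f" if "f \<in> \<Phi>" for f using \<Phi>(5)[OF that] by simp
  have "- M * (u \<bullet> u) \<le> app T u \<bullet> u" if u: "u \<in> Dom T" for u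
  proof -
    have "(\<delta> - app T f \<bullet> f) * (u \<bullet> f)\<^sup>2 \<le> (\<delta> - app T f \<bullet> f) * (u \<bullet> u)" if f: "f \<in> \<Phi>" for f
      using Cauchy_Schwarz_ineq[of u f] \<Phi>(2) f nonneg[OF f]
      by (intro mult_left_mono) (auto simp: orthonormal_def)
    then have "(\<Sum>f\<in>\<Phi>. (\<delta> - app T f \<bullet> f) * (u \<bullet> f)\<^sup>2) \<le> (\<Sum>f\<in>\<Phi>. (\<delta> - app T f \<bullet> f) * (u \<bullet> u))"
      by (rule sum_mono)
    moreover have "(\<Sum>f\<in>\<Phi>. (app T f \<bullet> f - \<delta>) * (u \<bullet> f)\<^sup>2) = - (\<Sum>f\<in>\<Phi>. (\<delta> - app T f \<bullet> f) * (u \<bullet> f)\<^sup>2)"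
      by (simp add: sum_negf[symmetric] algebra_simps)
    moreover have "M * (u \<bullet> u) = \<bar>\<delta>\<bar> * (u \<bullet> u) + (\<Sum>f\<in>\<Phi>. (\<delta> - app T f \<bullet> f) * (u \<bullet> u))"
      by (simp add: M_def distrib_right sum_distrib_right)
    moreover have "- \<bar>\<delta>\<bar> * (u \<bullet> u) \<le> \<delta> * (u \<bullet> u)" by (rule mult_right_mono) auto
    ultimately show ?thesis
      using form_bound_with_eigenframe[OF assms order_refl frame u] by simp
  qed
  moreover have "M \<ge> 0" using nonneg by (simp add: M_def sum_nonneg)
  ultimately show ?thesis using that by blast
qed

text \<open>
  The counting function is the largest dimension on which the form of \<open>T - a\<close> is negative definite;
  this is the half of that statement which bounds it from below.  With fewer frame vectors than test
  vectors, a combination of the latter would be orthogonal to the frame, where the form is nonnegative.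
\<close>

lemma card_le_eigencount:
  assumes fin: "fin_discrete_below T \<delta>" and a: "a \<le> \<delta>"
    and I: "finite I" "\<And>i. i \<in> I \<Longrightarrow> x i \<in> Dom T"
    and neg: "\<And>c. \<exists>i\<in>I. c i \<noteq> 0 \<Longrightarrow>
      (\<Sum>i\<in>I. \<Sum>j\<in>I. c i * c j * (app T (x i) \<bullet> x j - a * (x i \<bullet> x j))) < 0"
  shows "card I \<le> eigencount T a"
proof (rule ccontr)
  assume "\<not> ?thesis"
  obtain \<Phi> where frame: "eigenframe T a \<Phi>" and "card \<Phi> = eigencount T a"
    using eigenframe_exists[OF fin a] by blast
  with \<open>\<not> ?thesis\<close> have "card \<Phi> < card I" by simp
  from underdetermined_system[OF eigenframeD(1)[OF frame] I(1) this, of "\<lambda>i f. x i \<bullet> f"]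
  obtain c where c: "\<exists>i\<in>I. c i \<noteq> 0" "\<And>f. f \<in> \<Phi> \<Longrightarrow> (\<Sum>i\<in>I. c i * (x i \<bullet> f)) = 0" by blast
  define u where "u = (\<Sum>i\<in>I. c i *\<^sub>R x i)"
  have u: "u \<in> Dom T" unfolding u_def using I(2) by (intro Dom_sum Dom_scale)
  have "a * (u \<bullet> u) \<le> app T u \<bullet> u"
    by (rule form_bound_off_eigenframe[OF fin a frame u]) (simp add: u_def inner_sum_left c(2))
  moreover have "app T u \<bullet> u - a * (u \<bullet> u) =
      (\<Sum>i\<in>I. \<Sum>j\<in>I. c i * c j * (app T (x i) \<bullet> x j - a * (x i \<bullet> x j)))"
  proof -
    have Tu: "app T u = (\<Sum>i\<in>I. c i *\<^sub>R app T (x i))" unfolding u_def by (rule app_sum[OF I])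
    have "app T u \<bullet> u = (\<Sum>i\<in>I. \<Sum>j\<in>I. c i * c j * (app T (x i) \<bullet> x j))"
      unfolding Tu inner_sum_left unfolding u_def inner_sum_right by (simp add: mult_ac)
    moreover have "u \<bullet> u = (\<Sum>i\<in>I. \<Sum>j\<in>I. c i * c j * (x i \<bullet> x j))"
      unfolding u_def inner_sum_left unfolding inner_sum_right by (simp add: mult_ac)
    ultimately show ?thesis
      by (simp add: sum_distrib_left right_diff_distrib sum_subtractf mult_ac)
  qed
  ultimately show False using neg[OF c(1)] by simp
qed

text \<open>
  The other half: when the frame is larger than the number of linear conditions, some normalised
  combination of frame vectors satisfies all of them.  The lower bound for the eigenvalues controls
  its image under \<open>T\<close>.
\<close>

lemma eigenframe_unit_vector_orthogonal:
  assumes frame: "eigenframe T a \<Phi>" and P: "finite P" "card P < card \<Phi>"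
    and low: "\<And>\<mu>. eigenvalue T \<mu> \<Longrightarrow> - \<Lambda> \<le> \<mu>"
  obtains u where "u \<in> Dom T" "u \<bullet> u = 1" "\<And>p. p \<in> P \<Longrightarrow> u \<bullet> w p = 0"
    "app T u \<bullet> u \<le> a" "norm (app T u) \<le> \<bar>\<Lambda>\<bar> + \<bar>a\<bar>"
proof -
  note \<Phi> = eigenframeD[OF frame]
  from underdetermined_system[OF P(1) \<Phi>(1) P(2), of "\<lambda>f p. f \<bullet> w p"]
  obtain c where c: "\<exists>f\<in>\<Phi>. c f \<noteq> 0" "\<And>p. p \<in> P \<Longrightarrow> (\<Sum>f\<in>\<Phi>. c f * (f \<bullet> w p)) = 0" by blast
  define s where "s = sqrt (\<Sum>f\<in>\<Phi>. (c f)\<^sup>2)"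
  have "(\<Sum>f\<in>\<Phi>. (c f)\<^sup>2) > 0" using c(1) \<Phi>(1) by (auto intro: sum_pos2)
  then have s: "s > 0" "s\<^sup>2 = (\<Sum>f\<in>\<Phi>. (c f)\<^sup>2)" by (simp_all add: s_def)
  define e where "e f = c f / s" for f
  have "(\<Sum>f\<in>\<Phi>. (e f)\<^sup>2) = (\<Sum>f\<in>\<Phi>. (c f)\<^sup>2) / s\<^sup>2"
    by (simp add: e_def power_divide sum_divide_distrib)
  then have e1: "(\<Sum>f\<in>\<Phi>. (e f)\<^sup>2) = 1" unfolding s(2)[symmetric] using s(1) by simp
  define u where "u = (\<Sum>f\<in>\<Phi>. e f *\<^sub>R f)"
  define \<mu> where "\<mu> f = app T f \<bullet> f" for f
  have Tu: "app T u = (\<Sum>f\<in>\<Phi>. (e f * \<mu> f) *\<^sub>R f)"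
    unfolding u_def \<mu>_def by (rule app_eigenframe_sum[OF frame])
  have \<mu>: "\<mu> f < a" "- \<Lambda> \<le> \<mu> f" if "f \<in> \<Phi>" for f
  proof -
    show "\<mu> f < a" using \<Phi>(5)[OF that] by (simp add: \<mu>_def)
    have "f \<in> eigenspace T (\<mu> f)" "f \<noteq> 0"
      using \<Phi>(2-4) that by (auto simp: eigenspace_def \<mu>_def orthonormal_def)
    then show "- \<Lambda> \<le> \<mu> f" using low by (auto simp: eigenvalue_def)
  qed
  show ?thesis
  proof (rule that)
    show "u \<in> Dom T" unfolding u_def using \<Phi>(3) by (intro Dom_sum Dom_scale)
    show "u \<bullet> u = 1"
      unfolding u_def orthonormal_inner_sum_sum[OF \<Phi>(2,1)] using e1 by (simp add: power2_eq_square)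
    show "u \<bullet> w p = 0" if "p \<in> P" for p
    proof -
      have "u \<bullet> w p = (\<Sum>f\<in>\<Phi>. c f * (f \<bullet> w p)) / s"
        by (simp add: u_def e_def inner_sum_left sum_divide_distrib)
      then show ?thesis using c(2)[OF that] by simp
    qed
    have "app T u \<bullet> u = (\<Sum>f\<in>\<Phi>. (e f)\<^sup>2 * \<mu> f)"
      unfolding Tu unfolding u_def orthonormal_inner_sum_sum[OF \<Phi>(2,1)]
      by (simp add: power2_eq_square mult_ac)
    also have "\<dots> \<le> (\<Sum>f\<in>\<Phi>. (e f)\<^sup>2 * a)"
      using \<mu>(1) by (intro sum_mono mult_left_mono) (auto intro: less_imp_le)
    finally show "app T u \<bullet> u \<le> a" using e1 by (simp add: sum_distrib_right[symmetric])
    have "(norm (app T u))\<^sup>2 = (\<Sum>f\<in>\<Phi>. (e f)\<^sup>2 * (\<mu> f)\<^sup>2)"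
      unfolding power2_norm_eq_inner Tu orthonormal_inner_sum_sum[OF \<Phi>(2,1)]
      by (simp add: power2_eq_square mult_ac)
    also have "\<dots> \<le> (\<Sum>f\<in>\<Phi>. (e f)\<^sup>2 * (\<bar>\<Lambda>\<bar> + \<bar>a\<bar>)\<^sup>2)"
    proof (intro sum_mono mult_left_mono)
      fix f assume "f \<in> \<Phi>"
      then have "\<bar>\<mu> f\<bar> \<le> \<bar>\<Lambda>\<bar> + \<bar>a\<bar>" using \<mu>[of f] by arith
      then show "(\<mu> f)\<^sup>2 \<le> (\<bar>\<Lambda>\<bar> + \<bar>a\<bar>)\<^sup>2" by (simp add: abs_le_square_iff[symmetric])
    qed simp
    also have "\<dots> = (\<bar>\<Lambda>\<bar> + \<bar>a\<bar>)\<^sup>2" using e1 by (simp add: sum_distrib_right[symmetric])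
    finally show "norm (app T u) \<le> \<bar>\<Lambda>\<bar> + \<bar>a\<bar>" by (rule power2_le_imp_le) simp
  qed
qed

lemma dim_eigenspace_pos:
  assumes "fin_discrete_below T \<delta>" "\<mu> < \<delta>" "eigenvalue T \<mu>"
  shows "dim (eigenspace T \<mu>) > 0"
proof -
  obtain S where "finite S" "eigenspace T \<mu> \<subseteq> span S" using eigenspace_finite_span[OF assms(1,2)] by blast
  from orthonormal_basis_exists[OF subspace_eigenspace this]
  obtain C where C: "finite C" "span C = eigenspace T \<mu>" "card C = dim (eigenspace T \<mu>)" by blast
  have "C \<noteq> {}" using C(2) assms(3) by (auto simp: eigenvalue_def)
  then show ?thesis using C by (simp add: card_gt_0_iff flip: C(3))
qed

lemma eigencount_add_le:
  assumes "fin_discrete_below T \<delta>" "b \<le> \<delta>" and F: "finite F" "\<And>\<mu>. \<mu> \<in> F \<Longrightarrow> a \<le> \<mu> \<and> \<mu> < b" and "a \<le> b"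
  shows "eigencount T a + (\<Sum>\<mu>\<in>F. dim (eigenspace T \<mu>)) \<le> eigencount T b"
proof -
  let ?E = "\<lambda>c. {\<mu>. \<mu> < c \<and> eigenvalue T \<mu>}" and ?F = "{\<mu> \<in> F. eigenvalue T \<mu>}"
  have fin: "finite (?E b)" by (rule finite_eigenvalues_below[OF assms(1,2)])
  have finF: "finite ?F" using F(1) by simp
  have fina: "finite (?E a)" by (rule finite_subset[OF _ fin]) (use \<open>a \<le> b\<close> in auto)
  have "dim (eigenspace T \<mu>) = 0" if "\<not> eigenvalue T \<mu>" for \<mu>
    using that dim_le_card[of "eigenspace T \<mu>" "{}"] by (auto simp: eigenvalue_def)
  then have "(\<Sum>\<mu>\<in>F. dim (eigenspace T \<mu>)) = (\<Sum>\<mu>\<in>?F. dim (eigenspace T \<mu>))"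
    using F(1) by (intro sum.mono_neutral_right) auto
  moreover have "?E a \<inter> ?F = {}" using F(2) by fastforce
  ultimately have "eigencount T a + (\<Sum>\<mu>\<in>F. dim (eigenspace T \<mu>)) =
      (\<Sum>\<mu>\<in>?E a \<union> ?F. dim (eigenspace T \<mu>))"
    unfolding eigencount_def using fina finF by (simp add: sum.union_disjoint)
  also have "\<dots> \<le> eigencount T b"
    unfolding eigencount_def using fin F(2) \<open>a \<le> b\<close> by (intro sum_mono2) auto
  finally show ?thesis .
qed

end

section \<open>Limits of forms and relatively compact perturbations\<close>

text \<open>
  Entrywise errors below \<open>\<eta>\<close> change the quadratic form by at most \<open>\<eta> * card I\<close> times the squared
  length of \<open>c\<close>, uniformly in \<open>c\<close>.
\<close>

lemma eventually_negative_definite: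
  fixes m :: "'n \<Rightarrow> 'i \<Rightarrow> 'i \<Rightarrow> real"
  assumes I: "finite I" and d: "\<And>i. i \<in> I \<Longrightarrow> d i < 0"
    and lim: "\<And>i j. i \<in> I \<Longrightarrow> j \<in> I \<Longrightarrow> ((\<lambda>n. m n i j) \<longlongrightarrow> (if i = j then d i else 0)) F"
  shows "\<forall>\<^sub>F n in F. \<forall>c. (\<exists>i\<in>I. c i \<noteq> 0) \<longrightarrow> (\<Sum>i\<in>I. \<Sum>j\<in>I. c i * c j * m n i j) < 0"
proof (cases "I = {}")
  case False
  define k where "k = Min ((\<lambda>i. - d i) ` I)"
  have "k > 0" using I False d by (auto simp: k_def)
  moreover have "k \<le> - d i" if "i \<in> I" for i unfolding k_def using I that by (intro Min_le) auto
  ultimately have k: "k > 0" "\<And>i. i \<in> I \<Longrightarrow> d i \<le> - k" by fastforce+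
  define \<eta> where "\<eta> = k / (2 * card I)"
  have "card I > 0" using I False by (simp add: card_gt_0_iff)
  then have \<eta>: "\<eta> > 0" "\<eta> * card I = k / 2" using k by (simp_all add: \<eta>_def)
  have "\<forall>\<^sub>F n in F. \<forall>i\<in>I. \<forall>j\<in>I. \<bar>m n i j - (if i = j then d i else 0)\<bar> < \<eta>"
    using I lim \<eta>(1) by (auto simp: eventually_ball_finite_distrib tendsto_iff dist_real_def)
  then show ?thesis
  proof (eventually_elim, intro allI impI)
    fix n and c :: "'i \<Rightarrow> real"
    assume *: "\<forall>i\<in>I. \<forall>j\<in>I. \<bar>m n i j - (if i = j then d i else 0)\<bar> < \<eta>" and c: "\<exists>i\<in>I. c i \<noteq> 0"
    define s where "s = (\<Sum>i\<in>I. (c i)\<^sup>2)"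
    have "s > 0" unfolding s_def using c I by (auto intro: sum_pos2)
    have "c i * c j * m n i j \<le> (if i = j then (c i)\<^sup>2 * - k else 0) + \<eta> * (((c i)\<^sup>2 + (c j)\<^sup>2) / 2)"
      if "i \<in> I" "j \<in> I" for i j
    proof -
      let ?d = "if i = j then d i else 0"
      have "c i * c j * (m n i j - ?d) \<le> \<bar>c i * c j\<bar> * \<bar>m n i j - ?d\<bar>"
        by (metis abs_ge_self abs_mult)
      also have "\<dots> \<le> \<bar>c i * c j\<bar> * \<eta>" 
        by (rule mult_left_mono[OF less_imp_le]) (use *[rule_format, OF that] in simp_all)
      also have "\<bar>c i * c j\<bar> \<le> ((c i)\<^sup>2 + (c j)\<^sup>2) / 2"
        using sum_squares_bound[of "\<bar>c i\<bar>" "\<bar>c j\<bar>"] unfolding abs_mult power2_abs by (simp add: field_simps)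
      finally have "c i * c j * (m n i j - ?d) \<le> \<eta> * (((c i)\<^sup>2 + (c j)\<^sup>2) / 2)"
        using \<eta>(1) by (simp add: mult.commute)
      moreover have "c i * c j * ?d \<le> (if i = j then (c i)\<^sup>2 * - k else 0)"
        using k(2)[OF that(1)] mult_left_mono[of "d i" "- k" "(c i)\<^sup>2"]
        by (auto simp: power2_eq_square)
      ultimately show ?thesis by (simp add: right_diff_distrib)
    qed
    then have "(\<Sum>i\<in>I. \<Sum>j\<in>I. c i * c j * m n i j) \<le>
        (\<Sum>i\<in>I. \<Sum>j\<in>I. (if i = j then (c i)\<^sup>2 * - k else 0) + \<eta> * (((c i)\<^sup>2 + (c j)\<^sup>2) / 2))"
      by (intro sum_mono)
    also have "\<dots> = s * - k + \<eta> * card I * s"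
    proof -
      have "(\<Sum>i\<in>I. \<Sum>j\<in>I. if i = j then (c i)\<^sup>2 * - k else 0) = s * - k"
        using I by (simp add: s_def sum_distrib_right sum_negf)
      moreover have "(\<Sum>i\<in>I. \<Sum>j\<in>I. ((c i)\<^sup>2 + (c j)\<^sup>2) / 2) = card I * s"
        by (simp add: sum.distrib add_divide_distrib sum_divide_distrib[symmetric] s_def
            sum_distrib_left[symmetric])
      moreover have "(\<Sum>i\<in>I. \<Sum>j\<in>I. (if i = j then (c i)\<^sup>2 * - k else 0)
          + \<eta> * (((c i)\<^sup>2 + (c j)\<^sup>2) / 2)) = (\<Sum>i\<in>I. \<Sum>j\<in>I. if i = j then (c i)\<^sup>2 * - k else 0)
          + \<eta> * (\<Sum>i\<in>I. \<Sum>j\<in>I. ((c i)\<^sup>2 + (c j)\<^sup>2) / 2)"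
        by (simp only: sum.distrib sum_distrib_left)
      ultimately show ?thesis by (simp only: mult.assoc)
    qed
    also have "\<dots> < 0" using \<eta>(2) \<open>s > 0\<close> k(1) by simp
    finally show "(\<Sum>i\<in>I. \<Sum>j\<in>I. c i * c j * m n i j) < 0" .
  qed
qed simp

text \<open>
  If the inequality failed for every \<open>C\<close>, there would be vectors \<open>x m\<close>, bounded by \<open>1 / \<eta>\<close>, with
  \<open>norm (K (x m)) = 1\<close> and \<open>G (x m)\<close> tending to \<open>0\<close>.  Symmetry of \<open>G\<close> makes them weakly null on the
  dense range of \<open>G\<close>, which contradicts compactness.
\<close>

lemma compact_map_relative_bound:
  fixes K G :: "'a::{real_inner, complete_space} \<Rightarrow> 'a"
  assumes K: "compact_map K" and G: "linear G" "\<And>x y. G x \<bullet> y = x \<bullet> G y" "closure (range G) = UNIV"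
    and "\<eta> > 0"
  obtains C where "C \<ge> 0" "\<And>x. norm (K x) \<le> \<eta> * norm x + C * norm (G x)"
proof (rule ccontr)
  interpret K: bounded_linear K using K by (rule compact_map_bounded_linear)
  interpret G: linear G by fact
  assume no: "\<not> thesis"
  have "\<exists>x. norm (K x) = 1 \<and> norm x \<le> 1 / \<eta> \<and> norm (G x) \<le> inverse (real (Suc m))" for m
  proof -
    have "\<not> (\<forall>x. norm (K x) \<le> \<eta> * norm x + real (Suc m) * norm (G x))"
      using no that[of "real (Suc m)"] by auto
    then obtain x where x: "\<eta> * norm x + real (Suc m) * norm (G x) < norm (K x)"
      by (auto simp: not_le)
    define k where "k = norm (K x)"
    have nn: "0 \<le> \<eta> * norm x" "0 \<le> real (Suc m) * norm (G x)" using \<open>\<eta> > 0\<close> by simp_all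
    then have k: "k > 0" using x unfolding k_def by linarith
    have 1: "\<eta> * norm x \<le> k" "real (Suc m) * norm (G x) \<le> k" using x nn unfolding k_def by linarith+
    show ?thesis
    proof (intro exI[of _ "(1 / k) *\<^sub>R x"] conjI)
      show "norm (K ((1 / k) *\<^sub>R x)) = 1" using k by (simp add: K.scaleR flip: k_def)
      show "norm ((1 / k) *\<^sub>R x) \<le> 1 / \<eta>" using 1(1) k \<open>\<eta> > 0\<close> by (simp add: field_simps)
      show "norm (G ((1 / k) *\<^sub>R x)) \<le> inverse (real (Suc m))"
        using 1(2) k by (simp add: G.scaleR field_simps)
    qed
  qed
  then obtain x where x: "\<And>m. norm (K (x m)) = 1" "\<And>m. norm (x m) \<le> 1 / \<eta>"
    "\<And>m. norm (G (x m)) \<le> inverse (real (Suc m))" by metis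
  have Gx: "(\<lambda>m. G (x m)) \<longlonglongrightarrow> 0"
    by (rule Lim_null_comparison[OF _ LIMSEQ_inverse_real_of_nat]) (use x(3) in simp)
  have "weak_tendsto x 0 sequentially"
  proof (rule weak_null_from_dense[OF x(2) G(3)])
    fix y assume "y \<in> range G"
    then obtain z where "y = G z" by blast
    then show "(\<lambda>m. x m \<bullet> y) \<longlonglongrightarrow> 0"
      using tendsto_inner[OF Gx tendsto_const[of z]] by (simp add: G(2))
  qed
  from compact_map_weak_null[OF K x(2) this] have "(\<lambda>m. norm (K (x m))) \<longlonglongrightarrow> 0"
    by (rule tendsto_norm_zero)
  then show False using x(1) by (simp add: LIMSEQ_const_iff)
qed


lemma
  assumes "linear_isometry t"
  shows linear_isometry_inv: "linear_isometry (inv t)"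
    and linear_isometry_inv_left: "inv t (t u) = u"
    and linear_isometry_inv_right: "t (inv t u) = u"
proof -
  have t: "linear t" "bij t" "\<And>u. norm (t u) = norm u" using assms by (auto simp: linear_isometry_def)
  show l: "inv t (t u) = u" for u using t(2) by (simp add: bij_is_inj)
  show r: "t (inv t u) = u" for u using t(2) by (simp add: bij_is_surj surj_f_inv_f)
  have "norm (inv t u) = norm u" for u using t(3)[of "inv t u"] by (simp add: r)
  moreover have "linear (inv t)"
  proof (rule linearI)
    show "inv t (u + v) = inv t u + inv t v" for u v
      using l[of "inv t u + inv t v"] by (simp add: linear_add[OF t(1)] r)
    show "inv t (c *\<^sub>R u) = c *\<^sub>R inv t u" for c u
      using l[of "c *\<^sub>R inv t u"] by (simp add: linear_scale[OF t(1)] r)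
  qed
  ultimately show "linear_isometry (inv t)"
    using t(2) by (simp add: linear_isometry_def bij_imp_bij_inv)
qed

lemma linear_isometry_inner:
  fixes t :: "'a::real_inner \<Rightarrow> 'a"
  assumes "linear_isometry t"
  shows "t u \<bullet> t v = u \<bullet> v"
proof -
  have "(norm (t (u + v)))\<^sup>2 = (norm (u + v))\<^sup>2" using assms by (simp add: linear_isometry_def)
  then have "t u \<bullet> t u + 2 * (t u \<bullet> t v) + t v \<bullet> t v = u \<bullet> u + 2 * (u \<bullet> v) + v \<bullet> v"
    using assms
    by (simp add: linear_isometry_def linear_add power2_norm_eq_inner inner_add_left inner_add_right
        inner_commute)
  moreover have "t w \<bullet> t w = w \<bullet> w" for w
    using assms by (simp add: linear_isometry_def flip: power2_norm_eq_inner)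
  ultimately show ?thesis by simp
qed

section \<open>The asymptotically decoupled family\<close>

locale decoupled_perturbation =
  fixes N :: nat
    and \<tau> :: "nat \<Rightarrow> nat \<Rightarrow> 'a::{real_inner, complete_space} \<Rightarrow> 'a"
    and A :: "'a operator"
    and B R :: "nat \<Rightarrow> 'a operator"
    and \<delta> :: real
  assumes N: "N \<ge> 1"
    and isometries: "\<And>j n. j \<in> {1..N} \<Longrightarrow> linear_isometry (\<tau> j n)"
    and self_adjoint_A: "self_adjoint A"
    and self_adjoint_AB: "\<And>j. j \<in> {1..N} \<Longrightarrow> self_adjoint (A +\<^sub>o B j)"
    and Dom_AB: "\<And>j. j \<in> {1..N} \<Longrightarrow> Dom (A +\<^sub>o B j) = Dom A"
    and self_adjoint_L: "\<And>n. self_adjoint (L_op N A B R \<tau> n)"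
    and Dom_L: "\<And>n. Dom (L_op N A B R \<tau> n) = Dom A"
    and A_invertible: "op_invertible A"
    and A_commutes: "\<And>j n. j \<in> {1..N} \<Longrightarrow> A =\<^sub>o op_conj (\<tau> j n) A"
    and fin_A: "fin_discrete_below A \<delta>"
    and fin_AB: "\<And>j. j \<in> {1..N} \<Longrightarrow> fin_discrete_below (A +\<^sub>o B j) \<delta>"
    and fin_L: "\<And>n. fin_discrete_below (L_op N A B R \<tau> n) \<delta>"
    and R_bounded: "\<And>n. bounded_op (R n \<circ>\<^sub>o op_inv A)"
    and R_vanishes: "(\<lambda>n. onorm (app (R n \<circ>\<^sub>o op_inv A))) \<longlonglongrightarrow> 0"
    and cross_vanishes: "\<And>u j l. u \<in> Dom A \<Longrightarrow> j \<in> {1..N} \<Longrightarrow> l \<in> {1..N} \<Longrightarrow> j \<noteq> l \<Longrightarrow>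
        (\<lambda>n. norm (tau_quot \<tau> j l n (app (B l) (tau_quot \<tau> l j n u)))) \<longlonglongrightarrow> 0"
    and weakly_null: "\<And>u j k. j \<in> {1..N} \<Longrightarrow> k \<in> {1..N} \<Longrightarrow> j \<noteq> k \<Longrightarrow>
        weakly_converges (\<lambda>n. tau_quot \<tau> j k n u) 0"
    and B_compact: "\<And>j. j \<in> {1..N} \<Longrightarrow> compact_op (B j \<circ>\<^sub>o op_inv A)"
begin

abbreviation J :: "nat set" where "J \<equiv> {1..N}"

abbreviation L :: "nat \<Rightarrow> 'a operator" where "L \<equiv> L_op N A B R \<tau>"

abbreviation T :: "nat \<Rightarrow> 'a operator" where "T j \<equiv> A +\<^sub>o B j"

abbreviation \<tau>i :: "nat \<Rightarrow> nat \<Rightarrow> 'a \<Rightarrow> 'a" where "\<tau>i j n \<equiv> inv (\<tau> j n)"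

text \<open>
  Every vector of the common domain is \<open>G x\<close> with \<open>x\<close> its image under \<open>A\<close>.  In terms of \<open>x\<close> all
  perturbations are bounded operators: \<open>B j\<close> becomes the compact map \<open>K j\<close>, \<open>R n\<close> becomes \<open>Q n\<close>, and
  the whole perturbation of \<open>A\<close> in \<open>L n\<close> becomes \<open>S n\<close>.
\<close>

definition G :: "'a \<Rightarrow> 'a" where "G = app (op_inv A)"

definition K :: "nat \<Rightarrow> 'a \<Rightarrow> 'a" where "K j = app (B j \<circ>\<^sub>o op_inv A)"

definition Q :: "nat \<Rightarrow> 'a \<Rightarrow> 'a" where "Q n = app (R n \<circ>\<^sub>o op_inv A)"

definition S :: "nat \<Rightarrow> 'a \<Rightarrow> 'a" where "S n x = (\<Sum>j\<in>J. \<tau>i j n (K j (\<tau> j n x))) + Q n x"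

sublocale A: self_adjoint_operator A
  by unfold_locales (rule self_adjoint_A)

lemma self_adjoint_operator_T: "j \<in> J \<Longrightarrow> self_adjoint_operator (T j)"
  by unfold_locales (rule self_adjoint_AB)

sublocale L: self_adjoint_operator "L n" for n
  by unfold_locales (rule self_adjoint_L)

lemma isometry:
  assumes "j \<in> J"
  shows "linear (\<tau> j n)" "linear (\<tau>i j n)" "norm (\<tau> j n u) = norm u" "norm (\<tau>i j n u) = norm u"
    "\<tau>i j n (\<tau> j n u) = u" "\<tau> j n (\<tau>i j n u) = u"
    "\<tau> j n u \<bullet> v = u \<bullet> \<tau>i j n v" "\<tau>i j n u \<bullet> v = u \<bullet> \<tau> j n v"
proof -
  note t = isometries[OF assms, of n]
  note ti = linear_isometry_inv[OF t]
  show "linear (\<tau> j n)" "linear (\<tau>i j n)" "norm (\<tau> j n u) = norm u" "norm (\<tau>i j n u) = norm u"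
    using t ti by (auto simp: linear_isometry_def)
  show l: "\<tau>i j n (\<tau> j n u) = u" for u by (rule linear_isometry_inv_left[OF t])
  show r: "\<tau> j n (\<tau>i j n u) = u" for u by (rule linear_isometry_inv_right[OF t])
  show "\<tau> j n u \<bullet> v = u \<bullet> \<tau>i j n v"
    using linear_isometry_inner[OF ti, of "\<tau> j n u" v] by (simp add: l)
  show "\<tau>i j n u \<bullet> v = u \<bullet> \<tau> j n v"
    using linear_isometry_inner[OF t, of "\<tau>i j n u" v] by (simp add: r)
qed

lemma G_A: "u \<in> Dom A \<Longrightarrow> G (app A u) = u"
  using A_invertible inv_into_f_f[of "app A" "Dom A" u]
  by (simp add: op_invertible_def G_def op_inv_def bij_betw_def)

lemma A_G: "app A (G x) = x" and G_Dom: "G x \<in> Dom A"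
proof -
  have "x \<in> app A ` Dom A" using A_invertible by (simp add: op_invertible_def bij_betw_def)
  then show "app A (G x) = x" "G x \<in> Dom A"
    unfolding G_def op_inv_def operator.simps by (rule f_inv_into_f, rule inv_into_into)
qed

lemma bounded_linear_G: "bounded_linear G"
  using A_invertible by (simp add: op_invertible_def bounded_op_def G_def)

lemma G_symmetric: "G x \<bullet> y = x \<bullet> G y"
  using A.symmetric[OF G_Dom G_Dom, of x y] by (simp add: A_G)

lemma range_G: "range G = Dom A"
  using G_Dom G_A by (metis image_subset_iff rangeI subsetI subset_antisym)

lemma A_isometry:
  assumes "j \<in> J" "u \<in> Dom A"
  shows "\<tau> j n u \<in> Dom A" "app A (\<tau> j n u) = \<tau> j n (app A u)"
    "\<tau>i j n u \<in> Dom A" "app A (\<tau>i j n u) = \<tau>i j n (app A u)"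
proof -
  have "A =\<^sub>o op_conj (\<tau> j n) A" by (rule A_commutes[OF assms(1)])
  then have *: "u \<in> Dom A \<longleftrightarrow> \<tau> j n u \<in> Dom A"
    "u \<in> Dom A \<Longrightarrow> app A u = \<tau>i j n (app A (\<tau> j n u))" for u
    by (auto simp: op_eq_def op_conj_def everywhere_def op_comp_def)
  show 1: "\<tau> j n u \<in> Dom A" "app A (\<tau> j n u) = \<tau> j n (app A u)"
    using *(1)[of u] *(2)[OF assms(2)] assms(2) by (simp_all add: isometry(6)[OF assms(1)])
  show 2: "\<tau>i j n u \<in> Dom A"
    using *(1)[of "\<tau>i j n u"] assms(2) by (simp add: isometry(6)[OF assms(1)])
  show "app A (\<tau>i j n u) = \<tau>i j n (app A u)"
    using *(2)[OF 2] by (simp add: isometry[OF assms(1)])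
qed

lemma G_isometry:
  assumes "j \<in> J"
  shows "G (\<tau> j n x) = \<tau> j n (G x)" "G (\<tau>i j n x) = \<tau>i j n (G x)"
proof -
  show "G (\<tau> j n x) = \<tau> j n (G x)"
    using G_A[OF A_isometry(1)[OF assms G_Dom], of n x] by (simp add: A_isometry[OF assms G_Dom] A_G)
  show "G (\<tau>i j n x) = \<tau>i j n (G x)"
    using G_A[OF A_isometry(3)[OF assms G_Dom], of n x] by (simp add: A_isometry[OF assms G_Dom] A_G)
qed

lemma compact_map_K: "j \<in> J \<Longrightarrow> compact_map (K j)"
  using B_compact by (simp add: compact_op_def compact_map_def K_def)

lemma bounded_linear_Q: "bounded_linear (Q n)"
  using R_bounded by (simp add: bounded_op_def Q_def)

lemma app_T: "u \<in> Dom A \<Longrightarrow> app (T j) u = app A u + K j (app A u)"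
  using G_A[of u] by (simp add: op_plus_def K_def op_comp_def G_def)

lemma app_L:
  assumes "u \<in> Dom A"
  shows "app (L n) u = app A u + S n (app A u)"
proof -
  have "app (B_conj B \<tau> j n) u = \<tau>i j n (K j (\<tau> j n (app A u)))" if "j \<in> J" for j
    using G_A[OF A_isometry(1)[OF that assms], of n] A_isometry(2)[OF that assms, of n]
    by (simp add: B_conj_def op_conj_def everywhere_def op_comp_def K_def G_def)
  then have "(\<Sum>j\<in>J. app (B_conj B \<tau> j n) u) = (\<Sum>j\<in>J. \<tau>i j n (K j (\<tau> j n (app A u))))"
    by (rule sum.cong[OF refl])
  moreover have "app (R n) u = Q n (app A u)"
    using G_A[OF assms] by (simp add: Q_def op_comp_def G_def)
  ultimately show ?thesis by (simp add: L_op_def op_plus_def op_sum_def S_def)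
qed

lemma Q_vanishes:
  assumes "F \<le> sequentially" "\<And>n. norm (x n) \<le> C"
  shows "((\<lambda>n. Q n (x n)) \<longlongrightarrow> 0) F"
proof (rule Lim_null_comparison)
  have "norm (Q n (x n)) \<le> onorm (Q n) * C" for n
    using onorm[OF bounded_linear_Q, of n "x n"]
      mult_left_mono[OF assms(2) onorm_pos_le[OF bounded_linear_Q], of n n] by simp
  then show "\<forall>\<^sub>F n in F. norm (Q n (x n)) \<le> onorm (Q n) * C" by simp
  show "((\<lambda>n. onorm (Q n) * C) \<longlongrightarrow> 0) F"
    using tendsto_mult_left_zero[OF tendsto_mono[OF assms(1) R_vanishes]] by (simp add: Q_def)
qed

lemma isometries_weakly_null:
  assumes "j \<in> J" "k \<in> J" "j \<noteq> k"
  shows "weak_tendsto (\<lambda>n. \<tau> j n (\<tau>i k n x)) 0 sequentially"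
  using weakly_null[OF assms, of x] bounded_linear_inner_left
  unfolding weakly_converges_def weak_tendsto_def tau_quot_def by fastforce

lemma inner_profiles:
  assumes "j \<in> J" "k \<in> J"
  shows "(\<lambda>n. \<tau>i j n u \<bullet> \<tau>i k n v) \<longlonglongrightarrow> (if j = k then u \<bullet> v else 0)"
proof (cases "j = k")
  case True
  then show ?thesis using assms by (simp add: isometry)
next
  case False
  then show ?thesis
    using isometries_weakly_null[OF assms(2,1), of u]
    by (simp add: weak_tendsto_def isometry(7)[OF assms(2), symmetric])
qed

lemma cross_terms_vanish:
  assumes j: "j \<in> J" "l \<in> J" "j \<noteq> l"
  shows "(\<lambda>n. K l (\<tau> l n (\<tau>i j n x))) \<longlonglongrightarrow> 0"
proof -
  have "norm (tau_quot \<tau> j l n (app (B l) (tau_quot \<tau> l j n (G x)))) = norm (K l (\<tau> l n (\<tau>i j n x)))" for n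
    using j G_isometry[of l n "\<tau>i j n x"] G_isometry[of j n x]
    by (simp add: tau_quot_def isometry K_def op_comp_def flip: G_def)
  then show ?thesis
    using cross_vanishes[OF G_Dom[of x] j] by (simp add: tendsto_norm_zero_iff)
qed

text \<open>
  Of the perturbation of \<open>A\<close> only the summand with the same translation survives: the summands with
  \<open>l \<noteq> j\<close> are the vanishing cross terms.
\<close>

lemma L_on_profile:
  assumes j: "j \<in> J" and v: "v \<in> Dom A"
  shows "(\<lambda>n. app (L n) (\<tau>i j n v) - \<tau>i j n (app (T j) v)) \<longlonglongrightarrow> 0"
proof -
  let ?x = "app A v"
  have "app (L n) (\<tau>i j n v) - \<tau>i j n (app (T j) v) =
      (\<Sum>l\<in>J - {j}. \<tau>i l n (K l (\<tau> l n (\<tau>i j n ?x)))) + Q n (\<tau>i j n ?x)" for n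
  proof -
    have "app (L n) (\<tau>i j n v) = \<tau>i j n ?x + S n (\<tau>i j n ?x)"
      using app_L[OF A_isometry(3)[OF j v]] A_isometry(4)[OF j v] by simp
    moreover have "S n (\<tau>i j n ?x) = \<tau>i j n (K j ?x) +
        (\<Sum>l\<in>J - {j}. \<tau>i l n (K l (\<tau> l n (\<tau>i j n ?x)))) + Q n (\<tau>i j n ?x)"
    proof -
      have "(\<Sum>l\<in>J. \<tau>i l n (K l (\<tau> l n (\<tau>i j n ?x)))) = \<tau>i j n (K j (\<tau> j n (\<tau>i j n ?x))) +
          (\<Sum>l\<in>J - {j}. \<tau>i l n (K l (\<tau> l n (\<tau>i j n ?x))))"
        by (rule sum.remove[OF finite_atLeastAtMost j])
      then show ?thesis unfolding S_def isometry(6)[OF j] by simp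
    qed
    moreover have "\<tau>i j n (app (T j) v) = \<tau>i j n ?x + \<tau>i j n (K j ?x)"
      by (simp add: app_T[OF v] linear_add[OF isometry(2)[OF j]])
    ultimately show ?thesis by simp
  qed
  moreover have "(\<lambda>n. \<Sum>l\<in>J - {j}. \<tau>i l n (K l (\<tau> l n (\<tau>i j n ?x)))) \<longlonglongrightarrow> 0"
  proof (rule tendsto_null_sum)
    fix l assume "l \<in> J - {j}"
    then have "(\<lambda>n. norm (K l (\<tau> l n (\<tau>i j n ?x)))) \<longlonglongrightarrow> 0"
      using cross_terms_vanish[of j l] j by (auto simp: tendsto_norm_zero)
    then show "(\<lambda>n. \<tau>i l n (K l (\<tau> l n (\<tau>i j n ?x)))) \<longlonglongrightarrow> 0"
      by (subst tendsto_norm_zero_iff[symmetric]) (use \<open>l \<in> J - {j}\<close> in \<open>simp add: isometry\<close>)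
  qed
  moreover have "(\<lambda>n. Q n (\<tau>i j n ?x)) \<longlonglongrightarrow> 0"
    by (rule Q_vanishes[where C = "norm ?x"]) (simp_all add: isometry(4)[OF j])
  ultimately show ?thesis using tendsto_add by fastforce
qed

text \<open>
  Applied to \<open>x n = app A (w n)\<close>, this says that a remainder \<open>w n\<close> which is weakly null in every moving
  frame only sees \<open>A\<close>: each compact \<open>K j\<close> turns weak into strong convergence in its own frame.
\<close>

lemma S_on_remainder:
  assumes F: "F \<le> sequentially" and bd: "\<And>n. norm (x n) \<le> C"
    and weak: "\<And>j. j \<in> J \<Longrightarrow> weak_tendsto (\<lambda>n. \<tau> j n (x n)) 0 F"
  shows "((\<lambda>n. S n (x n)) \<longlongrightarrow> 0) F"
proof -
  have "((\<lambda>n. \<Sum>j\<in>J. \<tau>i j n (K j (\<tau> j n (x n)))) \<longlongrightarrow> 0) F"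
  proof (rule tendsto_null_sum)
    fix j assume j: "j \<in> J"
    have "((\<lambda>n. norm (K j (\<tau> j n (x n)))) \<longlongrightarrow> 0) F"
      by (intro tendsto_norm_zero compact_map_weak_null[OF compact_map_K[OF j] _ weak[OF j], of C])
        (simp add: isometry(3)[OF j] bd)
    then show "((\<lambda>n. \<tau>i j n (K j (\<tau> j n (x n)))) \<longlongrightarrow> 0) F"
      by (subst tendsto_norm_zero_iff[symmetric]) (simp add: isometry(4)[OF j])
  qed
  from tendsto_add[OF this Q_vanishes[OF F bd]] show ?thesis by (simp add: S_def)
qed

lemma S_relative_bound:
  obtains C where "C \<ge> 0" "\<forall>\<^sub>F n in sequentially. \<forall>x. norm (S n x) \<le> norm x / 4 + C * norm (G x)"
proof -
  \<comment> \<open>A budget of \<open>1 / 8\<close> for the \<open>N\<close> compact summands together, and another one for \<open>Q n\<close>.\<close>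
  define \<eta> where "\<eta> = 1 / (8 * real N)"
  have "\<eta> > 0" "N * \<eta> = 1 / 8" using N by (simp_all add: \<eta>_def)
  have dense: "closure (range G) = UNIV" using A.dense_Dom by (simp add: range_G)
  have "\<exists>C\<ge>0. \<forall>x. norm (K j x) \<le> \<eta> * norm x + C * norm (G x)" if "j \<in> J" for j
    using compact_map_relative_bound[OF compact_map_K[OF that] bounded_linear.linear[OF bounded_linear_G]
        G_symmetric dense \<open>\<eta> > 0\<close>] by metis
  then obtain C where C: "\<And>j. j \<in> J \<Longrightarrow> C j \<ge> 0"
    "\<And>j x. j \<in> J \<Longrightarrow> norm (K j x) \<le> \<eta> * norm x + C j * norm (G x)" by metis
  have "\<forall>\<^sub>F n in sequentially. onorm (Q n) < 1 / 8"
    using order_tendstoD(2)[OF R_vanishes, of "1 / 8"] by (simp add: Q_def)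
  then have "\<forall>\<^sub>F n in sequentially. \<forall>x. norm (S n x) \<le> norm x / 4 + (\<Sum>j\<in>J. C j) * norm (G x)"
  proof (eventually_elim, intro allI)
    fix n x assume "onorm (Q n) < 1 / 8"
    then have "norm (Q n x) \<le> norm x / 8"
      using onorm[OF bounded_linear_Q, of n x] mult_right_mono[of "onorm (Q n)" "1 / 8" "norm x"] by simp
    moreover have "norm (\<Sum>j\<in>J. \<tau>i j n (K j (\<tau> j n x))) \<le> (\<Sum>j\<in>J. \<eta> * norm x + C j * norm (G x))"
    proof (rule sum_norm_le)
      fix j assume j: "j \<in> J"
      show "norm (\<tau>i j n (K j (\<tau> j n x))) \<le> \<eta> * norm x + C j * norm (G x)"
        using C(2)[OF j, of "\<tau> j n x"] by (simp add: isometry[OF j] G_isometry[OF j])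
    qed
    moreover have "(\<Sum>j\<in>J. \<eta> * norm x + C j * norm (G x)) = norm x / 8 + (\<Sum>j\<in>J. C j) * norm (G x)"
      using \<open>N * \<eta> = 1 / 8\<close> by (simp add: sum.distrib sum_distrib_right flip: mult.assoc)
    ultimately show "norm (S n x) \<le> norm x / 4 + (\<Sum>j\<in>J. C j) * norm (G x)"
      unfolding S_def using norm_triangle_ineq[of "\<Sum>j\<in>J. \<tau>i j n (K j (\<tau> j n x))" "Q n x"] by simp
  qed
  moreover have "0 \<le> (\<Sum>j\<in>J. C j)" by (rule sum_nonneg) (rule C(1))
  ultimately show ?thesis using that by blast
qed

text \<open>
  Far to the left of the spectrum of \<open>A\<close>, the relative bound makes \<open>L n - \<mu>\<close> a small perturbation of
  \<open>A - \<mu>\<close>, uniformly in \<open>n\<close>.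
\<close>

lemma L_uniform_bounds:
  obtains \<Lambda> C where "\<forall>\<^sub>F n in sequentially. (\<forall>\<mu>. eigenvalue (L n) \<mu> \<longrightarrow> - \<Lambda> \<le> \<mu>) \<and>
    (\<forall>u\<in>Dom A. norm (app A u) \<le> 2 * (norm (app (L n) u) + C * norm u))"
proof -
  obtain M where M: "M \<ge> 0" "\<And>u. u \<in> Dom A \<Longrightarrow> - M * (u \<bullet> u) \<le> app A u \<bullet> u"
    using A.form_bounded_below[OF fin_A] by blast
  obtain C where C: "C \<ge> 0"
    "\<forall>\<^sub>F n in sequentially. \<forall>x. norm (S n x) \<le> norm x / 4 + C * norm (G x)"
    by (rule S_relative_bound)
  \<comment> \<open>For \<open>k > 2 * M\<close> the form of \<open>A + k\<close> is at least \<open>k / 2\<close>; against the relative bound this leaves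
    eigenvalues \<open>- k\<close> of \<open>L n\<close> only for \<open>k \<le> 8 * C\<close>.\<close>
  define \<Lambda> where "\<Lambda> = 2 * M + 8 * C"
  have "\<forall>\<^sub>F n in sequentially. (\<forall>\<mu>. eigenvalue (L n) \<mu> \<longrightarrow> - \<Lambda> \<le> \<mu>) \<and>
    (\<forall>u\<in>Dom A. norm (app A u) \<le> 2 * (norm (app (L n) u) + C * norm u))"
    using C(2)
  proof eventually_elim
    case (elim n)
    have rel: "norm (app (L n) u - app A u) \<le> norm (app A u) / 4 + C * norm u" if "u \<in> Dom A" for u
      using elim[rule_format, of "app A u"] by (simp add: app_L[OF that] G_A[OF that])
    have "- \<Lambda> \<le> \<mu>" if "eigenvalue (L n) \<mu>" for \<mu>
    proof (rule ccontr)
      assume "\<not> - \<Lambda> \<le> \<mu>"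
      define k where "k = - \<mu>"
      have k: "k > 2 * M + 8 * C" "k > 0"
        using \<open>\<not> - \<Lambda> \<le> \<mu>\<close> M(1) C(1) by (simp_all add: k_def \<Lambda>_def)
      obtain u where u: "u \<in> Dom A" "app (L n) u = - k *\<^sub>R u" "u \<noteq> 0"
        using \<open>eigenvalue (L n) \<mu>\<close> by (auto simp: eigenvalue_def eigenspace_def Dom_L k_def)
      define y where "y = norm (app A u + k *\<^sub>R u)"
      have "norm (app (L n) u - app A u) = y"
        unfolding y_def u(2) by (metis add.commute minus_add_distrib norm_minus_cancel scaleR_minus_left
            uminus_add_conv_diff add_uminus_conv_diff)
      then have 1: "y \<le> norm (app A u) / 4 + C * norm u" using rel[OF u(1)] by simp
      have "norm (app A u) \<le> y + k * norm u"
        using norm_triangle_ineq4[of "app A u + k *\<^sub>R u" "k *\<^sub>R u"] k by (simp add: y_def)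
      moreover have 2: "(k / 2) * norm u \<le> y"
      proof -
        have "(k - M) * (norm u * norm u) \<le> (app A u + k *\<^sub>R u) \<bullet> u"
          using M(2)[OF u(1)] by (simp add: inner_add_left left_diff_distrib dot_square_norm power2_eq_square)
        also have "\<dots> \<le> y * norm u" unfolding y_def by (rule norm_cauchy_schwarz)
        finally have "(k - M) * norm u \<le> y" using u(3) by (simp flip: mult.assoc)
        moreover have "(k / 2) * norm u \<le> (k - M) * norm u"
          using k(1) C(1) by (intro mult_right_mono) auto
        ultimately show ?thesis by simp
      qed
      ultimately have "y / 4 \<le> C * norm u" using 1 by argo
      then have "k * norm u \<le> 8 * C * norm u" using 2 by argo
      then have "k \<le> 8 * C" using u(3) by simp
      then show False using k(1) M(1) by simp
    qed
    moreover have "norm (app A u) \<le> 2 * (norm (app (L n) u) + C * norm u)" if u: "u \<in> Dom A" for u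
    proof -
      have "norm (app A u) \<le> norm (app (L n) u) + norm (app (L n) u - app A u)"
        using norm_triangle_ineq4[of "app (L n) u" "app (L n) u - app A u"] by simp
      moreover have "0 \<le> C * norm u" using C(1) by simp
      ultimately show ?thesis using rel[OF u] norm_ge_zero[of "app (L n) u"] by argo
    qed
    ultimately show ?case by blast
  qed
  then show ?thesis by (rule that)
qed

end


section \<open>Comparison of the counting functions\<close>

context decoupled_perturbation
begin

text \<open>
  The translated eigenvectors \<open>\<tau>i j n f\<close> are asymptotically orthonormal, and in this family the form of
  \<open>L n - a\<close> converges to the diagonal matrix of the numbers \<open>\<mu> - a\<close>, where \<open>\<mu> < a\<close> runs through the
  eigenvalues of all \<open>T j\<close>.
\<close>

lemma eventually_eigencount_ge:
  assumes "a \<le> \<delta>"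
  shows "\<forall>\<^sub>F n in sequentially. (\<Sum>j\<in>J. eigencount (T j) a) \<le> eigencount (L n) a"
proof -
  have "\<exists>\<Phi>. eigenframe (T j) a \<Phi> \<and> card \<Phi> = eigencount (T j) a" if "j \<in> J" for j
    using self_adjoint_operator.eigenframe_exists[OF self_adjoint_operator_T fin_AB] that assms by blast
  then obtain \<Phi> where frame: "\<And>j. j \<in> J \<Longrightarrow> eigenframe (T j) a (\<Phi> j)"
    and card: "\<And>j. j \<in> J \<Longrightarrow> card (\<Phi> j) = eigencount (T j) a" by metis
  note \<Phi> = eigenframeD[OF frame]
  have \<Phi>_Dom: "f \<in> Dom A" if "j \<in> J" "f \<in> \<Phi> j" for j f using \<Phi>(3)[OF that] Dom_AB[OF that(1)] by simp
  define I where "I = (SIGMA j:J. \<Phi> j)"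
  define x where "x n p = \<tau>i (fst p) n (snd p)" for n and p :: "nat \<times> 'a"
  define d where "d p = app (T (fst p)) (snd p) \<bullet> snd p - a" for p :: "nat \<times> 'a"
  have finI: "finite I" unfolding I_def using \<Phi>(1) by (intro finite_SigmaI) auto
  have cardI: "card I = (\<Sum>j\<in>J. eigencount (T j) a)"
    unfolding I_def using \<Phi>(1) card by (simp add: card_SigmaI)
  have "\<forall>\<^sub>F n in sequentially. \<forall>c. (\<exists>p\<in>I. c p \<noteq> 0) \<longrightarrow>
      (\<Sum>p\<in>I. \<Sum>q\<in>I. c p * c q * (app (L n) (x n p) \<bullet> x n q - a * (x n p \<bullet> x n q))) < 0"
  proof (rule eventually_negative_definite[OF finI])
    fix p assume "p \<in> I"
    then show "d p < 0" using \<Phi>(5) by (auto simp: I_def d_def)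
  next
    fix p q assume "p \<in> I" "q \<in> I"
    then obtain j f k g where p: "p = (j, f)" "j \<in> J" "f \<in> \<Phi> j" and q: "q = (k, g)" "k \<in> J" "g \<in> \<Phi> k"
      by (auto simp: I_def)
    define \<mu> where "\<mu> = app (T j) f \<bullet> f"
    have Tf: "app (T j) f = \<mu> *\<^sub>R f" unfolding \<mu>_def by (rule \<Phi>(4)[OF p(2,3)])
    have fg: "(\<lambda>n. x n p \<bullet> x n q) \<longlonglongrightarrow> (if p = q then 1 else 0)"
    proof -
      have "(if p = q then 1 else 0) = (if j = k then f \<bullet> g else 0)"
        using \<Phi>(2)[OF p(2)] p q by (auto simp: orthonormal_def)
      then show ?thesis using inner_profiles[OF p(2) q(2), of f g] by (simp add: x_def p(1) q(1))
    qed
    have "(\<lambda>n. (app (L n) (x n p) - \<mu> *\<^sub>R x n p) \<bullet> x n q) \<longlonglongrightarrow> 0"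
    proof (rule Lim_null_comparison)
      have "\<bar>(app (L n) (x n p) - \<mu> *\<^sub>R x n p) \<bullet> x n q\<bar> \<le> norm (app (L n) (x n p) - \<mu> *\<^sub>R x n p) * norm g" for n
        using Cauchy_Schwarz_ineq2[of _ "x n q"] by (simp add: x_def q(1) isometry(4)[OF q(2)])
      then show "\<forall>\<^sub>F n in sequentially. norm ((app (L n) (x n p) - \<mu> *\<^sub>R x n p) \<bullet> x n q)
          \<le> norm (app (L n) (x n p) - \<mu> *\<^sub>R x n p) * norm g" by simp
      have "(\<lambda>n. app (L n) (x n p) - \<mu> *\<^sub>R x n p) \<longlonglongrightarrow> 0"
        using L_on_profile[OF p(2) \<Phi>_Dom[OF p(2,3)]]
        by (simp add: x_def p(1) Tf linear_scale[OF isometry(2)[OF p(2)]])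
      then show "(\<lambda>n. norm (app (L n) (x n p) - \<mu> *\<^sub>R x n p) * norm g) \<longlonglongrightarrow> 0"
        by (intro tendsto_mult_left_zero tendsto_norm_zero)
    qed
    from tendsto_add[OF this tendsto_mult_left[OF fg, of "\<mu> - a"]]
    have "(\<lambda>n. app (L n) (x n p) \<bullet> x n q - a * (x n p \<bullet> x n q)) \<longlonglongrightarrow> (\<mu> - a) * (if p = q then 1 else 0)"
      by (simp add: inner_diff_left left_diff_distrib)
    moreover have "d p = \<mu> - a" by (simp add: d_def \<mu>_def p(1))
    then have "(\<mu> - a) * (if p = q then 1 else 0) = (if p = q then d p else 0)"
      by (cases "p = q") auto
    ultimately show "(\<lambda>n. app (L n) (x n p) \<bullet> x n q - a * (x n p \<bullet> x n q)) \<longlonglongrightarrow> (if p = q then d p else 0)"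
      by simp
  qed
  then show ?thesis
  proof eventually_elim
    case (elim n)
    have "x n p \<in> Dom (L n)" if "p \<in> I" for p
      using that A_isometry(3) \<Phi>_Dom by (auto simp: I_def x_def Dom_L)
    then show ?case
      using L.card_le_eigencount[OF fin_L \<open>a \<le> \<delta>\<close> finI, where x = "x n"] elim cardI by simp
  qed
qed

text \<open>
  If the count of \<open>L n\<close> exceeded the sum for infinitely many \<open>n\<close>, one could choose unit vectors \<open>u n\<close>,
  orthogonal to all translated eigenvectors, with \<open>app (L n) (u n) \<bullet> u n \<le> a'\<close>.  Along a finer filter
  each \<open>\<tau> j n (u n)\<close> has a weak limit \<open>v j\<close>, orthogonal to the eigenvectors of \<open>T j\<close> below \<open>a\<close>, and the
  remainder \<open>w n\<close> of \<open>u n\<close> after subtraction of the translated limits is weakly null in every moving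
  frame.  Mass and form decouple: the profiles contribute at least \<open>a * (v j \<bullet> v j)\<close> each, and the
  remainder contributes at least \<open>\<delta> * (w n \<bullet> w n)\<close> asymptotically, because \<open>A\<close> commutes with the
  isometries and \<open>\<tau> j n (w n)\<close> is asymptotically orthogonal to the eigenvectors of \<open>A\<close> below \<open>\<delta>\<close>.  Altogether the form is at least \<open>a > a'\<close> in the limit.
\<close>

lemma eventually_eigencount_le:
  assumes "a' < a" "a \<le> \<delta>"
  shows "\<forall>\<^sub>F n in sequentially. eigencount (L n) a' \<le> (\<Sum>j\<in>J. eigencount (T j) a)"
proof (rule ccontr)
  assume contra: "\<not> ?thesis"
  have "\<exists>\<Phi>. eigenframe (T j) a \<Phi> \<and> card \<Phi> = eigencount (T j) a" if "j \<in> J" for j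
    using self_adjoint_operator.eigenframe_exists[OF self_adjoint_operator_T fin_AB] that assms by blast
  then obtain \<Phi> where frame: "\<And>j. j \<in> J \<Longrightarrow> eigenframe (T j) a (\<Phi> j)"
    and card: "\<And>j. j \<in> J \<Longrightarrow> card (\<Phi> j) = eigencount (T j) a" by metis
  note \<Phi> = eigenframeD[OF frame]
  define I where "I = (SIGMA j:J. \<Phi> j)"
  have finI: "finite I" unfolding I_def using \<Phi>(1) by (intro finite_SigmaI) auto
  have cardI: "card I = (\<Sum>j\<in>J. eigencount (T j) a)"
    unfolding I_def using \<Phi>(1) card by (simp add: card_SigmaI)
  obtain \<Lambda> C where bounds: "\<forall>\<^sub>F n in sequentially. (\<forall>\<mu>. eigenvalue (L n) \<mu> \<longrightarrow> - \<Lambda> \<le> \<mu>) \<and>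
    (\<forall>u\<in>Dom A. norm (app A u) \<le> 2 * (norm (app (L n) u) + C * norm u))" by (rule L_uniform_bounds)
  \<comment> \<open>\<open>C1\<close> bounds \<open>app A u\<close> for unit vectors \<open>u\<close> in the spectral subspace of \<open>L n\<close> below \<open>a'\<close>.\<close>
  define C1 where "C1 = 2 * (\<bar>\<Lambda>\<bar> + \<bar>a'\<bar> + C)"
  define good where "good n u \<longleftrightarrow> u \<in> Dom A \<and> u \<bullet> u = 1 \<and> (\<forall>j\<in>J. \<forall>f\<in>\<Phi> j. \<tau> j n u \<bullet> f = 0) \<and>
    app (L n) u \<bullet> u \<le> a' \<and> norm (app A u) \<le> C1" for n u
  have some: "\<forall>\<^sub>F n in sequentially. (\<exists>u. good n u) \<or> eigencount (L n) a' \<le> (\<Sum>j\<in>J. eigencount (T j) a)"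
    using bounds
  proof eventually_elim
    case (elim n)
    show ?case
    proof (rule disjCI)
      assume "\<not> eigencount (L n) a' \<le> (\<Sum>j\<in>J. eigencount (T j) a)"
      moreover obtain \<Psi> where \<Psi>: "eigenframe (L n) a' \<Psi>" "card \<Psi> = eigencount (L n) a'"
        using L.eigenframe_exists[OF fin_L, of a' n] assms by auto
      ultimately have "card I < card \<Psi>" using cardI by simp
      from L.eigenframe_unit_vector_orthogonal[OF \<Psi>(1) finI this, of \<Lambda> "\<lambda>p. \<tau>i (fst p) n (snd p)"] elim
      obtain u where u: "u \<in> Dom (L n)" "u \<bullet> u = 1" "\<And>p. p \<in> I \<Longrightarrow> u \<bullet> \<tau>i (fst p) n (snd p) = 0"
        "app (L n) u \<bullet> u \<le> a'" "norm (app (L n) u) \<le> \<bar>\<Lambda>\<bar> + \<bar>a'\<bar>" by blast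
      have orth: "\<tau> j n u \<bullet> f = 0" if "j \<in> J" "f \<in> \<Phi> j" for j f
        using u(3)[of "(j, f)"] that by (simp add: I_def isometry(7)[OF that(1)])
      have "norm u = 1" using u(2) by (simp add: norm_eq_1)
      moreover have "norm (app A u) \<le> 2 * (norm (app (L n) u) + C * norm u)"
        using elim u(1) by (simp add: Dom_L)
      ultimately have "norm (app A u) \<le> C1" using u(5) by (simp add: C1_def)
      then have "good n u" using u orth by (simp add: good_def Dom_L)
      then show "\<exists>u. good n u" by blast
    qed
  qed
  have freq: "\<not> (\<forall>\<^sub>F n in sequentially. \<not> (\<exists>u. good n u))"
  proof
    assume "\<forall>\<^sub>F n in sequentially. \<not> (\<exists>u. good n u)"
    with some have "\<forall>\<^sub>F n in sequentially. eigencount (L n) a' \<le> (\<Sum>j\<in>J. eigencount (T j) a)"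
      by eventually_elim blast
    with contra show False ..
  qed
  define F0 where "F0 = inf sequentially (principal {n. \<exists>u. good n u})"
  have "F0 \<noteq> bot" using freq by (simp add: F0_def trivial_limit_def eventually_inf_principal)
  \<comment> \<open>The default \<open>0\<close> keeps the bounds and orthogonality relations valid for every \<open>n\<close>; only the
    normalisation and the bound for the form need a good vector.\<close>
  define u where "u n = (if \<exists>u. good n u then SOME u. good n u else 0)" for n
  have good_u: "good n (u n)" if "\<exists>u. good n u" for n
    using that by (simp add: u_def someI_ex)
  have app_A_0: "app A 0 = 0" using A.app_scale[OF A.subspace_Dom[THEN subspace_0], of 0] by simp
  have u_Dom: "u n \<in> Dom A" for n
    using good_u[of n] subspace_0[OF A.subspace_Dom] by (cases "\<exists>u. good n u") (auto simp: good_def u_def)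
  have u_orth: "\<tau> j n (u n) \<bullet> f = 0" if "j \<in> J" "f \<in> \<Phi> j" for j n f
    using good_u[of n] that linear_0[OF isometry(1)[OF that(1)]]
    by (cases "\<exists>u. good n u") (auto simp: good_def u_def)
  have Au_bd: "norm (app A (u n)) \<le> \<bar>C1\<bar>" for n
    using good_u[of n] app_A_0 by (cases "\<exists>u. good n u") (auto simp: good_def u_def intro: order_trans[OF _ abs_ge_self])

  have "norm (\<tau> j n (app A (u n))) \<le> \<bar>C1\<bar>" if "j \<in> J" for j n
    using Au_bd by (simp add: isometry(3)[OF that])
  from bounded_weak_cluster[OF \<open>F0 \<noteq> bot\<close>, of J "\<lambda>j n. \<tau> j n (app A (u n))", OF this]
  obtain F z where "F \<le> F0" "F \<noteq> bot"
    and z: "\<And>j. j \<in> J \<Longrightarrow> weak_tendsto (\<lambda>n. \<tau> j n (app A (u n))) (z j) F" by blast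
  have F: "F \<le> sequentially" using \<open>F \<le> F0\<close> by (simp add: F0_def)
  have good_F: "\<forall>\<^sub>F n in F. good n (u n)"
    using \<open>F \<le> F0\<close> by (rule filter_leD) (auto simp: F0_def eventually_inf_principal good_u)
  define v where "v j = G (z j)" for j
  have v_Dom: "v j \<in> Dom A" for j by (simp add: v_def G_Dom)
  define r where "r n = app A (u n) - (\<Sum>k\<in>J. \<tau>i k n (z k))" for n
  define w where "w n = u n - (\<Sum>k\<in>J. \<tau>i k n (v k))" for n
  interpret G: bounded_linear G by (rule bounded_linear_G)
  have w_eq: "w n = G (r n)" for n
    by (simp add: w_def r_def G.diff G.sum G_A[OF u_Dom] G_isometry v_def)
  have w_Dom: "w n \<in> Dom A" and Aw: "app A (w n) = r n" for n
    by (simp_all add: w_eq G_Dom A_G)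
  have r_bd: "norm (r n) \<le> \<bar>C1\<bar> + (\<Sum>k\<in>J. norm (z k))" for n
  proof -
    have "norm (\<Sum>k\<in>J. \<tau>i k n (z k)) \<le> (\<Sum>k\<in>J. norm (z k))"
      by (rule sum_norm_le) (simp add: isometry(4))
    then show ?thesis
      unfolding r_def using norm_triangle_ineq4[of "app A (u n)" "\<Sum>k\<in>J. \<tau>i k n (z k)"] Au_bd[of n] by simp
  qed
  have r_weak: "weak_tendsto (\<lambda>n. \<tau> j n (r n)) 0 F" if j: "j \<in> J" for j
  proof -
    have "weak_tendsto (\<lambda>n. \<tau> j n (\<tau>i k n (z k))) (if k = j then z j else 0) F" if "k \<in> J" for k
      using weak_tendsto_mono[OF isometries_weakly_null[OF j that] F] weak_tendsto_const
      by (auto simp: isometry(6)[OF j])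
    then have "weak_tendsto (\<lambda>n. \<Sum>k\<in>J. \<tau> j n (\<tau>i k n (z k))) (\<Sum>k\<in>J. if k = j then z j else 0) F"
      by (rule weak_tendsto_sum)
    from weak_tendsto_diff[OF z[OF j] this] show ?thesis
      using j by (simp add: r_def linear_diff[OF isometry(1)[OF j]] linear_sum[OF isometry(1)[OF j]])
  qed
  have w_weak: "((\<lambda>n. \<tau> j n (w n) \<bullet> y) \<longlongrightarrow> 0) F" if j: "j \<in> J" for j y
    using r_weak[OF j] by (simp add: weak_tendsto_def w_eq G_symmetric flip: G_isometry[OF j])
  have v_orth: "v j \<bullet> f = 0" if j: "j \<in> J" "f \<in> \<Phi> j" for j f
  proof -
    have "\<tau> j n (app A (u n)) \<bullet> G f = 0" for n
      using u_orth[OF j, of n] by (simp add: G_isometry[OF j(1)] G_A[OF u_Dom] flip: G_symmetric)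
    moreover have "((\<lambda>n. \<tau> j n (app A (u n)) \<bullet> G f) \<longlongrightarrow> z j \<bullet> G f) F"
      using z[OF j(1)] by (simp add: weak_tendsto_def)
    ultimately have "z j \<bullet> G f = 0" using \<open>F \<noteq> bot\<close> by (simp add: tendsto_const_iff)
    then show ?thesis by (simp add: v_def G_symmetric)
  qed

  \<comment> \<open>Decoupling of the mass and of the form.\<close>
  define P where "P n = (\<Sum>k\<in>J. \<tau>i k n (app (T k) (v k)))" for n
  define V where "V n = (\<Sum>k\<in>J. \<tau>i k n (v k))" for n
  have u_eq: "u n = V n + w n" for n by (simp add: w_def V_def)
  have profiles: "((\<lambda>n. (\<Sum>k\<in>J. \<tau>i k n (p k)) \<bullet> (\<Sum>l\<in>J. \<tau>i l n (q l))) \<longlongrightarrow> (\<Sum>k\<in>J. p k \<bullet> q k)) F" for p q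
  proof -
    have "((\<lambda>n. \<Sum>k\<in>J. \<Sum>l\<in>J. \<tau>i k n (p k) \<bullet> \<tau>i l n (q l)) \<longlongrightarrow> (\<Sum>k\<in>J. \<Sum>l\<in>J. if k = l then p k \<bullet> q l else 0)) F"
      by (intro tendsto_sum tendsto_mono[OF F inner_profiles])
    then show ?thesis unfolding inner_sum_left unfolding inner_sum_right by simp
  qed
  have profile_w: "((\<lambda>n. (\<Sum>k\<in>J. \<tau>i k n (p k)) \<bullet> w n) \<longlongrightarrow> 0) F" for p
    unfolding inner_sum_left
  proof (rule tendsto_null_sum)
    fix k assume k: "k \<in> J"
    show "((\<lambda>n. \<tau>i k n (p k) \<bullet> w n) \<longlongrightarrow> 0) F"
      using w_weak[OF k, of "p k"] unfolding isometry(8)[OF k] by (simp add: inner_commute)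
  qed
  have r_profile: "((\<lambda>n. r n \<bullet> (\<Sum>k\<in>J. \<tau>i k n (p k))) \<longlongrightarrow> 0) F" for p
    unfolding inner_sum_right
    by (rule tendsto_null_sum) (use r_weak in \<open>simp add: isometry(7)[symmetric] weak_tendsto_def\<close>)
  have mass: "((\<lambda>n. u n \<bullet> u n - w n \<bullet> w n) \<longlongrightarrow> (\<Sum>k\<in>J. v k \<bullet> v k)) F"
  proof -
    have "u n \<bullet> u n - w n \<bullet> w n = V n \<bullet> V n + 2 * (V n \<bullet> w n)" for n
      by (simp add: u_eq inner_add_left inner_add_right inner_commute)
    moreover have "((\<lambda>n. V n \<bullet> V n + 2 * (V n \<bullet> w n)) \<longlongrightarrow> (\<Sum>k\<in>J. v k \<bullet> v k) + 2 * 0) F"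
      unfolding V_def by (intro tendsto_add tendsto_mult profiles profile_w tendsto_const)
    ultimately show ?thesis by simp
  qed
  define E where "E n = app (L n) (u n) - (P n + r n)" for n
  have E: "((\<lambda>n. E n) \<longlongrightarrow> 0) F"
  proof -
    have E_eq: "E = (\<lambda>n. (\<Sum>k\<in>J. app (L n) (\<tau>i k n (v k)) - \<tau>i k n (app (T k) (v k))) + S n (r n))"
    proof
      fix n
      have V_Dom: "V n \<in> Dom A"
        unfolding V_def by (intro A.Dom_sum A_isometry(3) v_Dom)
      have "app (L n) (V n) = (\<Sum>k\<in>J. app (L n) (\<tau>i k n (v k)))"
        using L.app_sum[of J "\<lambda>k. \<tau>i k n (v k)" n "\<lambda>_. 1"] A_isometry(3)[OF _ v_Dom]
        by (simp add: V_def Dom_L)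
      moreover have "app (L n) (u n) = app (L n) (V n) + app (L n) (w n)"
        unfolding u_eq using V_Dom w_Dom by (intro L.app_add) (simp_all add: Dom_L)
      moreover have "app (L n) (w n) = r n + S n (r n)" by (simp add: app_L[OF w_Dom] Aw)
      ultimately show "E n = (\<Sum>k\<in>J. app (L n) (\<tau>i k n (v k)) - \<tau>i k n (app (T k) (v k))) + S n (r n)"
        by (simp add: E_def P_def sum_subtractf)
    qed
    have "((\<lambda>n. (\<Sum>k\<in>J. app (L n) (\<tau>i k n (v k)) - \<tau>i k n (app (T k) (v k))) + S n (r n)) \<longlongrightarrow> 0 + 0) F"
      by (intro tendsto_add tendsto_null_sum tendsto_mono[OF F L_on_profile] v_Dom
          S_on_remainder[OF F r_bd r_weak])
    then show ?thesis unfolding E_eq by simp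
  qed
  have form: "((\<lambda>n. app (L n) (u n) \<bullet> u n - r n \<bullet> w n) \<longlongrightarrow> (\<Sum>k\<in>J. app (T k) (v k) \<bullet> v k)) F"
  proof -
    have "app (L n) (u n) \<bullet> u n - r n \<bullet> w n = E n \<bullet> u n + (P n \<bullet> V n + P n \<bullet> w n + r n \<bullet> V n)" for n
    proof -
      have "app (L n) (u n) = E n + P n + r n" by (simp add: E_def)
      then have "app (L n) (u n) \<bullet> u n = E n \<bullet> u n + P n \<bullet> u n + r n \<bullet> u n" by (simp add: inner_add_left)
      moreover have "P n \<bullet> u n = P n \<bullet> V n + P n \<bullet> w n" "r n \<bullet> u n = r n \<bullet> V n + r n \<bullet> w n"
        unfolding u_eq by (rule inner_add_right)+
      ultimately show ?thesis by simp
    qed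
    moreover have "((\<lambda>n. E n \<bullet> u n) \<longlongrightarrow> 0) F"
    proof (rule Lim_null_comparison)
      show "\<forall>\<^sub>F n in F. norm (E n \<bullet> u n) \<le> norm (E n)"
        using good_F
      proof eventually_elim
        case (elim n)
        then have "norm (u n) = 1" by (simp add: good_def norm_eq_1)
        then show ?case using Cauchy_Schwarz_ineq2[of "E n" "u n"] by simp
      qed
      show "((\<lambda>n. norm (E n)) \<longlongrightarrow> 0) F" using E by (rule tendsto_norm_zero)
    qed
    moreover have "((\<lambda>n. P n \<bullet> V n + P n \<bullet> w n + r n \<bullet> V n) \<longlongrightarrow> (\<Sum>k\<in>J. app (T k) (v k) \<bullet> v k) + 0 + 0) F"
      unfolding P_def V_def by (intro tendsto_add profiles profile_w r_profile)
    ultimately show ?thesis using tendsto_add by fastforce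
  qed

  \<comment> \<open>On the remainder, which vanishes weakly, the form of \<open>A\<close> is asymptotically bounded below by \<open>\<delta>\<close>.\<close>
  obtain \<Psi> where \<Psi>: "eigenframe A \<delta> \<Psi>" using A.eigenframe_exists[OF fin_A order_refl] by blast
  have "1 \<in> J" using N by simp
  then obtain i where i: "i \<in> J" by blast
  define \<rho> where "\<rho> n = (\<Sum>f\<in>\<Psi>. (app A f \<bullet> f - \<delta>) * (\<tau> i n (w n) \<bullet> f)\<^sup>2)" for n
  have \<rho>: "(\<rho> \<longlongrightarrow> 0) F"
  proof -
    have "(\<rho> \<longlongrightarrow> (\<Sum>f\<in>\<Psi>. (app A f \<bullet> f - \<delta>) * 0\<^sup>2)) F"
      unfolding \<rho>_def by (intro tendsto_sum tendsto_mult tendsto_const tendsto_power w_weak i)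
    then show ?thesis by simp
  qed
  have remainder: "\<delta> * (w n \<bullet> w n) + \<rho> n \<le> r n \<bullet> w n" for n
    using A.form_bound_with_eigenframe[OF fin_A order_refl \<Psi> A_isometry(1)[OF i w_Dom], of n n]
    by (simp add: \<rho>_def A_isometry(2)[OF i w_Dom] Aw isometry(7)[OF i] isometry(5)[OF i])

  define s where "s = (\<Sum>k\<in>J. v k \<bullet> v k)"
  define t where "t = (\<Sum>k\<in>J. app (T k) (v k) \<bullet> v k)"
  have "a * s \<le> t"
    unfolding s_def t_def sum_distrib_left
  proof (rule sum_mono)
    fix k assume k: "k \<in> J"
    show "a * (v k \<bullet> v k) \<le> app (T k) (v k) \<bullet> v k"
      using self_adjoint_operator.form_bound_off_eigenframe[OF self_adjoint_operator_T[OF k] fin_AB[OF k]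
          assms(2) frame[OF k]] v_Dom Dom_AB[OF k] v_orth[OF k] by simp
  qed
  have w_mass: "((\<lambda>n. w n \<bullet> w n) \<longlongrightarrow> 1 - s) F"
  proof -
    have "((\<lambda>n. 1 - (u n \<bullet> u n - w n \<bullet> w n)) \<longlongrightarrow> 1 - s) F"
      unfolding s_def by (intro tendsto_diff tendsto_const mass)
    then show ?thesis
      by (rule Lim_transform_eventually) (use good_F in eventually_elim, simp add: good_def)
  qed
  have "0 \<le> 1 - s"
    by (rule tendsto_lowerbound[OF w_mass _ \<open>F \<noteq> bot\<close>]) simp
  have "((\<lambda>n. (app (L n) (u n) \<bullet> u n - r n \<bullet> w n) + (\<delta> * (w n \<bullet> w n) + \<rho> n)) \<longlongrightarrow> t + (\<delta> * (1 - s) + 0)) F"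
    unfolding t_def by (intro tendsto_add tendsto_mult tendsto_const form w_mass \<rho>)
  moreover have "\<forall>\<^sub>F n in F. (app (L n) (u n) \<bullet> u n - r n \<bullet> w n) + (\<delta> * (w n \<bullet> w n) + \<rho> n) \<le> a'"
    using good_F
  proof eventually_elim
    case (elim n)
    then have "app (L n) (u n) \<bullet> u n \<le> a'" by (simp add: good_def)
    then show ?case using remainder[of n] by simp
  qed
  ultimately have "t + (\<delta> * (1 - s) + 0) \<le> a'"
    using \<open>F \<noteq> bot\<close> by (rule tendsto_upperbound)
  moreover have "a * (1 - s) \<le> \<delta> * (1 - s)" using assms(2) \<open>0 \<le> 1 - s\<close> by (rule mult_right_mono)
  ultimately show False using \<open>a * s \<le> t\<close> \<open>a' < a\<close> by (simp add: right_diff_distrib)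
qed

end

section \<open>Inertia\<close>

lemma op_kernel_eq_eigenspace: "op_kernel T = eigenspace T 0"
  by (simp add: op_kernel_def eigenspace_def)

lemma inertia_eigencount:
  "inertia T = (eigencount T 0, dim (eigenspace T 0))"
  by (simp add: inertia_def eigencount_def op_kernel_eq_eigenspace)

lemma eigencount_cong:
  assumes "\<And>\<mu>. eigenvalue T \<mu> \<Longrightarrow> \<mu> < a \<longleftrightarrow> \<mu> < b"
  shows "eigencount T a = eigencount T b"
  unfolding eigencount_def using assms by (intro sum.cong) auto

theorem corollary4p5:
  fixes N :: nat
    and \<tau> :: "nat \<Rightarrow> nat \<Rightarrow> 'a::{real_inner, complete_space} \<Rightarrow> 'a"
    and A :: "'a operator"
    and B R :: "nat \<Rightarrow> 'a operator"
    and \<delta> :: real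
    and n\<^sub>L :: nat
  assumes N: "N \<ge> 1"
    and isometries: "\<And>j n. j \<in> {1..N} \<Longrightarrow> linear_isometry (\<tau> j n)"
    and linA: "lin_op A"
    and linB: "\<And>j. j \<in> {1..N} \<Longrightarrow> lin_op (B j)"
    and linR: "\<And>n. lin_op (R n)"
    and A1_A: "self_adjoint A"
    and A1_AB: "\<And>j. j \<in> {1..N} \<Longrightarrow> self_adjoint (A +\<^sub>o B j) \<and> Dom (A +\<^sub>o B j) = Dom A"
    and A1_ABn: "\<And>j n. j \<in> {1..N} \<Longrightarrow>
        self_adjoint (A +\<^sub>o B_conj B \<tau> j n) \<and> Dom (A +\<^sub>o B_conj B \<tau> j n) = Dom A"
    and A1_L: "\<And>n. self_adjoint (L_op N A B R \<tau> n) \<and> Dom (L_op N A B R \<tau> n) = Dom A"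
    and A2_inv: "op_invertible A"
    and A2_comm: "\<And>j n. j \<in> {1..N} \<Longrightarrow> A =\<^sub>o op_conj (\<tau> j n) A"
    and A3_\<delta>: "\<delta> > 0"
    and A3_A: "fin_discrete_below A \<delta>"
    and A3_AB: "\<And>j. j \<in> {1..N} \<Longrightarrow> fin_discrete_below (A +\<^sub>o B j) \<delta>"
    and A3_ABn: "\<And>j n. j \<in> {1..N} \<Longrightarrow> fin_discrete_below (A +\<^sub>o B_conj B \<tau> j n) \<delta>"
    and A3_L: "\<And>n. fin_discrete_below (L_op N A B R \<tau> n) \<delta>"
    and A4: "\<And>\<mu> j. \<mu> \<in> (\<Inter>i\<in>{1..N}. resolvent_set (A +\<^sub>o B i)) \<Longrightarrow> j \<in> {1..N} \<Longrightarrow>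
        bounded_op (A \<circ>\<^sub>o op_inv (op_shift (A +\<^sub>o B j) \<mu>))"
    and A5_bounded: "\<And>n. bounded_op (R n \<circ>\<^sub>o op_inv A)"
    and A5: "(\<lambda>n. onorm (app (R n \<circ>\<^sub>o op_inv A))) \<longlonglongrightarrow> 0"
    and A6: "\<And>u j l. u \<in> Dom A \<Longrightarrow> j \<in> {1..N} \<Longrightarrow> l \<in> {1..N} \<Longrightarrow> j \<noteq> l \<Longrightarrow>
        (\<lambda>n. norm (tau_quot \<tau> j l n (app (B l) (tau_quot \<tau> l j n u)))) \<longlonglongrightarrow> 0"
    and A7: "\<And>u j k. j \<in> {1..N} \<Longrightarrow> k \<in> {1..N} \<Longrightarrow> j \<noteq> k \<Longrightarrow>
        weakly_converges (\<lambda>n. tau_quot \<tau> j k n u) 0"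
    and A8: "\<And>j. j \<in> {1..N} \<Longrightarrow> compact_op (B j \<circ>\<^sub>o op_inv A)"
    and ker_dim: "\<And>n. n \<ge> n\<^sub>L \<Longrightarrow>
        dim (op_kernel (L_op N A B R \<tau> n)) \<ge> (\<Sum>j=1..N. dim (op_kernel (A +\<^sub>o B j)))"
  shows "(\<exists>n\<^sub>0\<ge>n\<^sub>L. \<forall>n\<ge>n\<^sub>0. inertia (L_op N A B R \<tau> n) = (\<Sum>j=1..N. inertia (A +\<^sub>o B j)))
       \<and> (\<exists>\<epsilon>>0. \<forall>\<^sub>F n in sequentially. \<forall>\<mu>.
            eigenvalue (L_op N A B R \<tau> n) \<mu> \<and> \<mu> \<noteq> 0 \<longrightarrow> \<bar>\<mu>\<bar> \<ge> \<epsilon>)"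
proof -
  interpret decoupled_perturbation N \<tau> A B R \<delta>
    by (unfold_locales; rule N isometries A1_A A1_AB[THEN conjunct1] A1_AB[THEN conjunct2]
        A1_L[THEN conjunct1] A1_L[THEN conjunct2] A2_inv A2_comm A3_A A3_AB A3_L A5_bounded A5 A6 A7 A8;
        assumption)
  let ?z = "\<Sum>j\<in>J. dim (eigenspace (T j) 0)" and ?n = "\<Sum>j\<in>J. eigencount (T j) 0"
  \<comment> \<open>\<open>2 * \<kappa>\<close> is the least of \<open>\<delta>\<close> and of the moduli of the non-zero eigenvalues below \<open>\<delta>\<close> of all \<open>T j\<close>;
    halving leaves the thresholds \<open>- \<kappa>\<close> and \<open>\<kappa>\<close> strictly off these eigenvalues.\<close>
  define Ev where "Ev = (\<Union>j\<in>J. {\<mu>. \<mu> < \<delta> \<and> eigenvalue (T j) \<mu>}) - {0}"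
  have "finite Ev"
    unfolding Ev_def using self_adjoint_operator.finite_eigenvalues_below[OF self_adjoint_operator_T fin_AB]
    by (intro finite_Diff finite_UN_I) auto
  define \<kappa> where "\<kappa> = Min (insert \<delta> (abs ` Ev)) / 2"
  have \<kappa>: "\<kappa> > 0" "\<kappa> < \<delta>"
  proof -
    have "Min (insert \<delta> (abs ` Ev)) > 0" using \<open>finite Ev\<close> A3_\<delta> by (auto simp: Ev_def)
    moreover have "Min (insert \<delta> (abs ` Ev)) \<le> \<delta>" using \<open>finite Ev\<close> by (intro Min_le) auto
    ultimately show "\<kappa> > 0" "\<kappa> < \<delta>" by (simp_all add: \<kappa>_def)
  qed
  have window: "\<kappa> < \<bar>\<mu>\<bar>" if "j \<in> J" "eigenvalue (T j) \<mu>" "\<mu> \<noteq> 0" for j \<mu>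
  proof (cases "\<mu> < \<delta>")
    case True
    then have "\<bar>\<mu>\<bar> \<in> abs ` Ev" using that unfolding Ev_def by blast
    then have "Min (insert \<delta> (abs ` Ev)) \<le> \<bar>\<mu>\<bar>" using \<open>finite Ev\<close> by (intro Min_le) auto
    then show ?thesis using \<kappa>(1) unfolding \<kappa>_def by linarith
  qed (use \<kappa> in linarith)
  have below: "eigencount (T j) (- \<kappa>) = eigencount (T j) 0" if "j \<in> J" for j
    by (rule eigencount_cong) (use window[OF that] \<kappa>(1) in fastforce)
  have above: "eigencount (T j) \<kappa> \<le> eigencount (T j) 0 + dim (eigenspace (T j) 0)" if "j \<in> J" for j
  proof -
    have fin: "finite {\<mu>. \<mu> < \<kappa> \<and> eigenvalue (T j) \<mu>}"
      using self_adjoint_operator.finite_eigenvalues_below[OF self_adjoint_operator_T[OF that] fin_AB[OF that]] \<kappa>(2)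
      by simp
    have sub: "{\<mu>. \<mu> < \<kappa> \<and> eigenvalue (T j) \<mu>} \<subseteq> {\<mu>. \<mu> < 0 \<and> eigenvalue (T j) \<mu>} \<union> {0}"
      using window[OF that] by fastforce
    have "finite {\<mu>. \<mu> < 0 \<and> eigenvalue (T j) \<mu>}"
      by (rule finite_subset[OF _ fin]) (use \<kappa>(1) in auto)
    then show ?thesis
      unfolding eigencount_def
      using sum_mono2[OF _ sub, of "\<lambda>\<mu>. dim (eigenspace (T j) \<mu>)"] by (simp add: sum.union_disjoint)
  qed
  have "\<forall>\<^sub>F n in sequentially. n \<ge> n\<^sub>L \<and> (\<Sum>j\<in>J. eigencount (T j) (- \<kappa>)) \<le> eigencount (L n) (- \<kappa>) \<and>
      eigencount (L n) (\<kappa> / 2) \<le> (\<Sum>j\<in>J. eigencount (T j) \<kappa>)"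
    using \<kappa> by (intro eventually_conj eventually_ge_at_top eventually_eigencount_ge eventually_eigencount_le) auto
  then have main: "\<forall>\<^sub>F n in sequentially. inertia (L n) = (\<Sum>j\<in>J. inertia (T j)) \<and>
      (\<forall>\<mu>. eigenvalue (L n) \<mu> \<and> \<mu> \<noteq> 0 \<longrightarrow> \<kappa> / 2 \<le> \<bar>\<mu>\<bar>)"
  proof eventually_elim
    case (elim n)
    have "(\<Sum>j\<in>J. eigencount (T j) (- \<kappa>)) = ?n" using below by (rule sum.cong[OF refl])
    then have low: "?n \<le> eigencount (L n) (- \<kappa>)" using elim by simp
    have "(\<Sum>j\<in>J. eigencount (T j) \<kappa>) \<le> (\<Sum>j\<in>J. eigencount (T j) 0 + dim (eigenspace (T j) 0))"
      by (rule sum_mono) (rule above)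
    then have high: "eigencount (L n) (\<kappa> / 2) \<le> ?n + ?z" using elim by (simp add: sum.distrib)
    have ker: "?z \<le> dim (eigenspace (L n) 0)"
      using ker_dim[of n] elim by (simp add: op_kernel_eq_eigenspace)
    have add: "eigencount (L n) (- \<kappa>) + (\<Sum>\<mu>\<in>X. dim (eigenspace (L n) \<mu>)) \<le> eigencount (L n) (\<kappa> / 2)"
      if "finite X" "\<And>\<mu>. \<mu> \<in> X \<Longrightarrow> - \<kappa> \<le> \<mu> \<and> \<mu> < \<kappa> / 2" for X
      using L.eigencount_add_le[OF fin_L _ that] \<kappa> by simp
    have gap: "\<kappa> / 2 \<le> \<mu> \<or> \<mu> < - \<kappa>" if "eigenvalue (L n) \<mu>" "\<mu> \<noteq> 0" for \<mu>
    proof (rule ccontr)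
      assume outside: "\<not> (\<kappa> / 2 \<le> \<mu> \<or> \<mu> < - \<kappa>)"
      then have "eigencount (L n) (- \<kappa>) + (\<Sum>\<nu>\<in>{0, \<mu>}. dim (eigenspace (L n) \<nu>)) \<le> eigencount (L n) (\<kappa> / 2)"
        using \<kappa>(1) by (intro add) auto
      moreover have "dim (eigenspace (L n) \<mu>) > 0"
        by (rule L.dim_eigenspace_pos[OF fin_L _ that(1)]) (use outside \<kappa> in simp)
      ultimately show False using low high ker that(2) by simp
    qed
    have "eigencount (L n) (- \<kappa>) = eigencount (L n) 0"
      by (rule eigencount_cong) (use gap \<kappa>(1) in fastforce)
    moreover have "eigencount (L n) (- \<kappa>) + dim (eigenspace (L n) 0) \<le> eigencount (L n) (\<kappa> / 2)"
      using add[of "{0}"] \<kappa>(1) by simp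
    ultimately have "eigencount (L n) 0 = ?n" "dim (eigenspace (L n) 0) = ?z"
      using low high ker by linarith+
    then have "inertia (L n) = (\<Sum>j\<in>J. inertia (T j))"
      by (simp add: inertia_eigencount prod_eq_iff fst_sum snd_sum)
    moreover have "\<kappa> / 2 \<le> \<bar>\<mu>\<bar>" if "eigenvalue (L n) \<mu>" "\<mu> \<noteq> 0" for \<mu>
      using gap[OF that] \<kappa>(1) by linarith
    ultimately show ?case by blast
  qed
  show ?thesis
  proof
    obtain n\<^sub>1 where "\<And>n. n \<ge> n\<^sub>1 \<Longrightarrow> inertia (L n) = (\<Sum>j\<in>J. inertia (T j))"
      using main unfolding eventually_sequentially by blast
    then show "\<exists>n\<^sub>0\<ge>n\<^sub>L. \<forall>n\<ge>n\<^sub>0. inertia (L n) = (\<Sum>j=1..N. inertia (T j))"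
      by (intro exI[of _ "max n\<^sub>L n\<^sub>1"]) simp
    show "\<exists>\<epsilon>>0. \<forall>\<^sub>F n in sequentially. \<forall>\<mu>. eigenvalue (L n) \<mu> \<and> \<mu> \<noteq> 0 \<longrightarrow> \<bar>\<mu>\<bar> \<ge> \<epsilon>"
      using main \<kappa>(1) by (intro exI[of _ "\<kappa> / 2"]) (auto elim: eventually_mono)
  qed
qed

end
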